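(* Let $\mathcal{X}$ and $\mathcal{Y}$ be compact Polish spaces and let $Z=(X,Y)$ be a data set of transition pairs of a Feller-continuous Markov kernel $p$ from $\mathcal{X}$ to $\mathcal{Y}$. Then $Z$ is empirically weakly converging (EWC) in probability (resp. almost surely) if, and only if, $X$ is EWC in probability (resp. almost surely). In this case, with $P$ the limit measure of $X$ and $J$ that of $Z$, we have $\mathbb{P}$-almost surely, for all $A\in\mathcal{B}(\mathcal{X})$ and $B\in\mathcal{B}(\mathcal{Y})$, $$J(A\times B)=\int_A p(B,x)\,\mathrm{d}P(x).$$
   Context: All random variables are defined on a complete standard Borel probability space $(\Omega,\mathcal{A},\mathbb{P})$. Polish spaces carry their Borel $\sigma$-algebra $\mathcal{B}(\cdot)$; products carry the product topology. $\mathcal{P}(\mathcal{X})$ is the set of Borel probability measures on $\mathcal{X}$ with the topology of weak convergence (which is metrizable). A random measure on $\mathcal{X}$ is a measurable map $P:\Omega\to\mathcal{P}(\mathcal{X})$. The empirical measure of a process $X=(X_n)_{n\ge1}$ is $\eta_n^X=\frac1n\sum_{i=1}^n\delta_{X_i}$. Definition (EWC): let $d$ be a metric on $\mathcal{P}(\mathcal{X})$ that metrizes weak convergence. An $\mathcal{X}$-valued process $X$ is EWC in probability (resp. almost surely) if there exists a random measure $P$ on $\mathcal{X}$ such that $\lim_{n\to\infty}d(\eta_n^X,P)=0$ in probability (resp. almost surely); $P$ is then called the limit measure of $X$ (it is $\mathbb{P}$-a.s. unique). A Markov kernel from $\mathcal{X}$ to $\mathcal{Y}$ is a map $p:\mathcal{B}(\mathcal{Y})\times\mathcal{X}\to[0,\infty)$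 such that $p(\cdot,x)$ is a probability measure on $\mathcal{Y}$ for every $x\in\mathcal{X}$ and $p(A,\cdot)$ is measurable for every $A\in\mathcal{B}(\mathcal{Y})$. It is Feller-continuous if for every continuous bounded $f:\mathcal{Y}\to\mathbb{R}$, the map $x\mapsto\int_{\mathcal{Y}} f(y)\,p(\mathrm{d}y,x)$ is continuous and bounded on $\mathcal{X}$. A data set of transition pairs of $p$ is an $\mathcal{X}\times\mathcal{Y}$-valued process $Z=(X,Y)$, i.e. $Z_n=(X_n,Y_n)$, such that $\mathbb{P}$-a.s., for all $n\ge1$, $\mathbb{P}[Y_n\in\cdot\mid X_1,\dots,X_n,Y_1,\dots,Y_{n-1}]=p(\cdot,X_n)$ (for $n=1$ the conditioning is on $X_1$ only). *)

theory Defs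
  imports "HOL-Probability.Probability"
begin

section \<open>Complete standard Borel probability spaces\<close>

definition standard_borel :: "'w measure \<Rightarrow> bool" where
  "standard_borel N \<longleftrightarrow>
     (\<exists>T. topspace T = space N \<and> completely_metrizable_space T \<and> second_countable T \<and>
          sets N = sigma_sets (space N) {U. openin T U})"

definition complete_standard_borel_prob_space :: "'w measure \<Rightarrow> bool" where
  "complete_standard_borel_prob_space M \<longleftrightarrow>
     (\<exists>N. prob_space N \<and> standard_borel N \<and> M = completion N)"

section \<open>Weak convergence of Borel probability measures\<close>

text \<open>The set of Borel probability measures is \<^term>\<open>space (prob_algebra borel)\<close>.\<close>

definition weak_topology :: "'a::topological_space measure topology" where
  "weak_topology = topology_generated_by
     {{\<mu> \<in> space (prob_algebra borel). (\<integral>x. f x \<partial>\<mu>) \<in> U} | (f :: 'a \<Rightarrow> real) U.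
        continuous_on UNIV f \<and> bounded (range f) \<and> open U}"

lemma topspace_weak_topology: "topspace weak_topology = space (prob_algebra borel)"
proof -
  have "\<exists>(f :: 'a \<Rightarrow> real) U. continuous_on UNIV f \<and> bounded (range f) \<and> open U \<and>
     space (prob_algebra borel) = {\<mu> \<in> space (prob_algebra borel). (\<integral>x. f x \<partial>\<mu>) \<in> U}"
    by (intro exI[of _ "\<lambda>_. 0"] exI[of _ UNIV]) (auto simp: image_def)
  then show ?thesis
    unfolding weak_topology_def topology_generated_by_topspace by blast
qed

definition metrizes_weak_convergence ::
    "('a::topological_space measure \<Rightarrow> 'a measure \<Rightarrow> real) \<Rightarrow> bool" where
  "metrizes_weak_convergence d \<longleftrightarrow>
     Metric_space (space (prob_algebra borel)) d \<and>
     Metric_space.mtopology (space (prob_algebra borel)) d = weak_topology"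

definition weak_borel :: "'a::topological_space measure measure" where
  "weak_borel = sigma (space (prob_algebra borel)) {U. openin weak_topology U}"

definition random_measure :: "'w measure \<Rightarrow> ('w \<Rightarrow> 'a::topological_space measure) \<Rightarrow> bool" where
  "random_measure M P \<longleftrightarrow> P \<in> M \<rightarrow>\<^sub>M weak_borel"

section \<open>Empirical measures and empirical weak convergence\<close>

text \<open>Processes are indexed by the positive integers: only the values at \<open>n \<ge> 1\<close> of a function
  on \<^typ>\<open>nat\<close> are used.\<close>

definition empirical_measure :: "(nat \<Rightarrow> 'a::topological_space) \<Rightarrow> nat \<Rightarrow> 'a measure" where
  "empirical_measure x n =
     measure_of UNIV (sets borel)
       (\<lambda>A. ennreal (1 / real n) * (\<Sum>i=1..n. emeasure (return borel (x i)) A))"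

lemma sets_empirical_measure [simp]: "sets (empirical_measure x n) = sets borel"
  unfolding empirical_measure_def
  using sets.sigma_sets_eq[of borel] by simp

lemma emeasure_empirical_measure:
  assumes "A \<in> sets borel"
  shows "emeasure (empirical_measure x n) A =
           ennreal (1 / real n) * (\<Sum>i=1..n. emeasure (return borel (x i)) A)"
proof -
  let ?m = "\<lambda>A. ennreal (1 / real n) * (\<Sum>i=1..n. emeasure (return borel (x i)) A)"
  have "countably_additive (sets borel) ?m"
  proof (rule countably_additiveI)
    fix F :: "nat \<Rightarrow> 'a set"
    assume F: "range F \<subseteq> sets borel" "disjoint_family F"
    have "(\<Sum>j. ?m (F j)) = ennreal (1 / real n) * (\<Sum>j. \<Sum>i=1..n. emeasure (return borel (x i)) (F j))"
      by (rule ennreal_suminf_cmult)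
    also have "\<dots> = ennreal (1 / real n) * (\<Sum>i=1..n. \<Sum>j. emeasure (return borel (x i)) (F j))"
      by (subst suminf_sum) auto
    also have "\<dots> = ?m (\<Union>j. F j)"
      using F by (simp only: suminf_emeasure sets_return)
    finally show "(\<Sum>j. ?m (F j)) = ?m (\<Union>j. F j)" .
  qed
  moreover have "sigma_algebra UNIV (sets (borel :: 'a measure))"
    using sets.sigma_algebra_axioms[of "borel :: 'a measure"] by simp
  ultimately show ?thesis
    unfolding empirical_measure_def
    using assms by (intro emeasure_measure_of_sigma) (auto simp: positive_def)
qed

lemma empirical_measure_in_prob_algebra:
  assumes "n \<ge> 1"
  shows "empirical_measure x n \<in> space (prob_algebra borel)"
proof -
  have sp: "space (empirical_measure x n) = UNIV"
    using sets_eq_imp_space_eq[OF sets_empirical_measure[of x n]] by simp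
  have "emeasure (empirical_measure x n) UNIV = ennreal (1 / real n) * of_nat n"
    by (subst emeasure_empirical_measure) auto
  also have "\<dots> = 1"
    using assms by (subst ennreal_of_nat_eq_real_of_nat, subst ennreal_mult[symmetric]) auto
  finally have "prob_space (empirical_measure x n)"
    by (intro prob_spaceI) (simp add: sp)
  then show ?thesis
    by (simp add: space_prob_algebra)
qed

text \<open>The events below are measurable for a process of random variables in a compact Polish space
  and a metric of weak convergence, so the default value \<open>0\<close> of \<^const>\<open>measure\<close> outside the
  sigma-algebra plays no role.\<close>

definition limit_measure_prob ::
    "'w measure \<Rightarrow> ('a::topological_space measure \<Rightarrow> 'a measure \<Rightarrow> real) \<Rightarrow>
     (nat \<Rightarrow> 'w \<Rightarrow> 'a) \<Rightarrow> ('w \<Rightarrow> 'a measure) \<Rightarrow> bool" where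
  "limit_measure_prob M d X P \<longleftrightarrow> random_measure M P \<and>
     (\<forall>\<epsilon>>0. (\<lambda>n. measure M {\<omega> \<in> space M. d (empirical_measure (\<lambda>i. X i \<omega>) n) (P \<omega>) > \<epsilon>})
              \<longlonglongrightarrow> 0)"

definition limit_measure_as ::
    "'w measure \<Rightarrow> ('a::topological_space measure \<Rightarrow> 'a measure \<Rightarrow> real) \<Rightarrow>
     (nat \<Rightarrow> 'w \<Rightarrow> 'a) \<Rightarrow> ('w \<Rightarrow> 'a measure) \<Rightarrow> bool" where
  "limit_measure_as M d X P \<longleftrightarrow> random_measure M P \<and>
     (AE \<omega> in M. (\<lambda>n. d (empirical_measure (\<lambda>i. X i \<omega>) n) (P \<omega>)) \<longlonglongrightarrow> 0)"

definition EWC_prob ::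
    "'w measure \<Rightarrow> ('a::topological_space measure \<Rightarrow> 'a measure \<Rightarrow> real) \<Rightarrow>
     (nat \<Rightarrow> 'w \<Rightarrow> 'a) \<Rightarrow> bool" where
  "EWC_prob M d X \<longleftrightarrow> (\<exists>P. limit_measure_prob M d X P)"

definition EWC_as ::
    "'w measure \<Rightarrow> ('a::topological_space measure \<Rightarrow> 'a measure \<Rightarrow> real) \<Rightarrow>
     (nat \<Rightarrow> 'w \<Rightarrow> 'a) \<Rightarrow> bool" where
  "EWC_as M d X \<longleftrightarrow> (\<exists>P. limit_measure_as M d X P)"

section \<open>Markov kernels and data sets of transition pairs\<close>

text \<open>\<open>measure (p x) B\<close> is \<open>p(B, x)\<close>.\<close>

definition markov_kernel :: "('a::topological_space \<Rightarrow> 'b::topological_space measure) \<Rightarrow> bool" where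
  "markov_kernel p \<longleftrightarrow>
     (\<forall>x. sets (p x) = sets borel \<and> prob_space (p x)) \<and>
     (\<forall>B\<in>sets borel. (\<lambda>x. measure (p x) B) \<in> borel_measurable borel)"

definition feller_continuous ::
    "('a::topological_space \<Rightarrow> 'b::topological_space measure) \<Rightarrow> bool" where
  "feller_continuous p \<longleftrightarrow>
     (\<forall>f :: 'b \<Rightarrow> real. continuous_on UNIV f \<and> bounded (range f) \<longrightarrow>
        continuous_on UNIV (\<lambda>x. \<integral>y. f y \<partial>p x) \<and> bounded (range (\<lambda>x. \<integral>y. f y \<partial>p x)))"

definition regular_cond_distribution ::
    "'w measure \<Rightarrow> 'w measure \<Rightarrow> ('w \<Rightarrow> 'b::topological_space) \<Rightarrow> ('w \<Rightarrow> 'b measure) \<Rightarrow> bool" where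
  "regular_cond_distribution M F Y \<kappa> \<longleftrightarrow>
     (\<forall>\<omega>\<in>space M. sets (\<kappa> \<omega>) = sets borel \<and> prob_space (\<kappa> \<omega>)) \<and>
     (\<forall>B\<in>sets borel. (\<lambda>\<omega>. measure (\<kappa> \<omega>) B) \<in> borel_measurable F \<and>
        (AE \<omega> in M. measure (\<kappa> \<omega>) B =
            real_cond_exp M F (indicator (Y -` B \<inter> space M)) \<omega>))"

text \<open>The sigma-algebra generated by \<open>X\<^sub>1, \<dots>, X\<^sub>n, Y\<^sub>1, \<dots>, Y\<^sub>n\<^sub>-\<^sub>1\<close>.\<close>

definition past_algebra ::
    "'w measure \<Rightarrow> (nat \<Rightarrow> 'w \<Rightarrow> 'a::topological_space) \<Rightarrow> (nat \<Rightarrow> 'w \<Rightarrow> 'b::topological_space) \<Rightarrow>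
     nat \<Rightarrow> 'w measure" where
  "past_algebra M X Y n = sigma (space M)
     ((\<Union>i\<in>{1..n}. {X i -` A \<inter> space M | A. A \<in> sets borel}) \<union>
      (\<Union>i\<in>{1..<n}. {Y i -` B \<inter> space M | B. B \<in> sets borel}))"

text \<open>\<open>\<kappa> n\<close> is a version of \<open>\<omega> \<mapsto> P[Y\<^sub>n \<in> \<cdot> | X\<^sub>1, \<dots>, X\<^sub>n, Y\<^sub>1, \<dots>, Y\<^sub>n\<^sub>-\<^sub>1](\<omega>)\<close>; versions are almost
  surely unique, so the choice of version is immaterial.\<close>

definition transition_pairs ::
    "'w measure \<Rightarrow> ('a::topological_space \<Rightarrow> 'b::topological_space measure) \<Rightarrow>
     (nat \<Rightarrow> 'w \<Rightarrow> 'a) \<Rightarrow> (nat \<Rightarrow> 'w \<Rightarrow> 'b) \<Rightarrow> bool" where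
  "transition_pairs M p X Y \<longleftrightarrow>
     (\<forall>n\<ge>1. X n \<in> M \<rightarrow>\<^sub>M borel \<and> Y n \<in> M \<rightarrow>\<^sub>M borel) \<and>
     (\<exists>\<kappa>. (\<forall>n\<ge>1. regular_cond_distribution M (past_algebra M X Y n) (Y n) (\<kappa> n)) \<and>
          (AE \<omega> in M. \<forall>n\<ge>1. \<kappa> n \<omega> = p (X n \<omega>)))"

end

theory Submission
  imports Defs "HOL-Library.Discrete_Functions"
begin

text \<open>
  For fixed continuous \<open>f\<close> and \<open>g\<close> the variables \<open>f(X\<^sub>i) (g(Y\<^sub>i) - \<integral>g dp(\<cdot>, X\<^sub>i))\<close> are bounded
  martingale differences, so their averages tend to \<open>0\<close> almost surely. Countably many such products
  have a uniformly dense span, so almost surely \<open>\<integral>h d\<eta>\<^sub>n\<^sup>Z - \<integral>(\<integral>h(x, y) p(dy, x)) d\<eta>\<^sub>n\<^sup>X\<close> tends to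
  \<open>0\<close> for all continuous \<open>h\<close> simultaneously. The Feller property makes \<open>\<mu> \<mapsto> \<mu>(dx) p(dy, x)\<close> weakly
  continuous, hence convergence of \<open>\<eta>\<^sup>X\<close> to \<open>P\<close> along any subsequence forces convergence of \<open>\<eta>\<^sup>Z\<close> to
  \<open>P(dx) p(dy, x)\<close>; the converse is continuity of the first marginal. Convergence in
  probability is reduced to almost sure convergence along subsequences.
\<close>

section \<open>Weak topology and empirical measures\<close>

text \<open>Nothing is assumed about how \<open>X\<close> evolves, so no average over
  \<open>X\<close> is available; what averages out is only the randomness of \<open>Y n\<close>
  given the past. The metrics \<open>dX\<close> and \<open>dZ\<close> are unrelated, so no estimate
  passes from one to the other: both are translated into \<open>limitin weak_topology\<close>, and
  convergence is transferred by the law of large numbers and by weakly continuous maps. The same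
  maps send random measures to random measures, which supplies the limit required by the definition
  of EWC. The transfer is a statement about one trajectory and is therefore made for an arbitrary
  index sequence tending to infinity, so that it covers the whole sequence as well as the
  subsequences that convergence in probability provides. Compactness gives finite nets, hence
  countably many test products, and uniform continuity, which makes their span dense and controls
  \<integral>h(x, y) p(dy, x) although x occurs in it twice. Orthogonality bounds the second moment
  of the n-th average only by a multiple of 1/n, which is not summable; this is why the strong law
  passes through the squares.\<close>

lemma continuous_map_integral_weak_topology:
  fixes f :: "'a::topological_space \<Rightarrow> real"
  assumes "continuous_on UNIV f" "bounded (range f)"
  shows "continuous_map weak_topology euclideanreal (\<lambda>\<mu>. \<integral>x. f x \<partial>\<mu>)"
proof -
  have "openin weak_topology {\<mu> \<in> space (prob_algebra borel). (\<integral>x. f x \<partial>\<mu>) \<in> U}" if "open U" for U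
    unfolding weak_topology_def using assms that by (intro topology_generated_by_Basis) blast
  then show ?thesis
    by (simp add: continuous_map topspace_weak_topology)
qed

text \<open>In a topology generated by a subbase, convergence need only be tested on subbasic sets,
  and these constrain a single integral each. Membership is required only eventually because an
  empirical measure of zero points is not a probability measure.\<close>

lemma limitin_weak_topology:
  fixes \<mu> :: "'a::topological_space measure"
  shows "limitin weak_topology m \<mu> F \<longleftrightarrow>
    \<mu> \<in> space (prob_algebra borel) \<and> (\<forall>\<^sub>F n in F. m n \<in> space (prob_algebra borel)) \<and>
    (\<forall>f :: 'a \<Rightarrow> real. continuous_on UNIV f \<and> bounded (range f) \<longrightarrow>
       ((\<lambda>n. \<integral>x. f x \<partial>m n) \<longlongrightarrow> (\<integral>x. f x \<partial>\<mu>)) F)" (is "?L \<longleftrightarrow> ?R")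
proof
  assume L: ?L
  have "((\<lambda>n. \<integral>x. f x \<partial>m n) \<longlongrightarrow> (\<integral>x. f x \<partial>\<mu>)) F"
    if "continuous_on UNIV f" "bounded (range f)" for f :: "'a \<Rightarrow> real"
    using continuous_map_limit[OF continuous_map_integral_weak_topology[OF that] L]
    by (simp add: comp_def)
  moreover have "\<forall>\<^sub>F n in F. m n \<in> topspace weak_topology"
    using L unfolding limitin_def by blast
  ultimately show ?R
    using L by (simp add: limitin_def topspace_weak_topology)
next
  assume R: ?R
  have "\<forall>\<^sub>F n in F. m n \<in> U" if "openin weak_topology U" "\<mu> \<in> U" for U
    using that(1)[unfolded weak_topology_def openin_topology_generated_by_iff] that(2)
  proof induct
    case (Int a b)
    then show ?case by (auto intro: eventually_conj)
  next
    case (UN K)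
    then obtain k where "k \<in> K" "\<forall>\<^sub>F n in F. m n \<in> k" by blast
    then show ?case by (auto elim: eventually_mono)
  next
    case (Basis s)
    then obtain f :: "'a \<Rightarrow> real" and U
      where s: "s = {\<mu> \<in> space (prob_algebra borel). (\<integral>x. f x \<partial>\<mu>) \<in> U}"
        and f: "continuous_on UNIV f" "bounded (range f)" and "open U" by blast
    have "\<forall>\<^sub>F n in F. (\<integral>x. f x \<partial>m n) \<in> U"
      using R f Basis.prems \<open>open U\<close> s by (intro topological_tendstoD) auto
    then show ?case using R unfolding s by (auto elim: eventually_elim2)
  qed simp
  then show ?L using R by (simp add: limitin_def topspace_weak_topology)
qed

text \<open>Continuity by duality: if test functions pull back to test functions, preimages of
  subbasic sets are subbasic. It serves for both maps between the two spaces of measures, the joint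
  law and the first marginal.\<close>

lemma continuous_map_weak_topologyI:
  fixes \<Phi> :: "'a::topological_space measure \<Rightarrow> 'b::topological_space measure"
  assumes "\<And>\<mu>. \<mu> \<in> space (prob_algebra borel) \<Longrightarrow> \<Phi> \<mu> \<in> space (prob_algebra borel)"
    and "\<And>h :: 'b \<Rightarrow> real. continuous_on UNIV h \<Longrightarrow> bounded (range h) \<Longrightarrow>
      \<exists>f :: 'a \<Rightarrow> real. continuous_on UNIV f \<and> bounded (range f) \<and>
        (\<forall>\<mu>\<in>space (prob_algebra borel). (\<integral>y. h y \<partial>\<Phi> \<mu>) = (\<integral>x. f x \<partial>\<mu>))"
  shows "continuous_map weak_topology weak_topology \<Phi>"
  unfolding weak_topology_def[where ?'a = 'b]
proof (rule continuous_on_generated_topo)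
  fix V assume "V \<in> {{\<mu> \<in> space (prob_algebra borel). (\<integral>x. f x \<partial>\<mu>) \<in> U} | (f :: 'b \<Rightarrow> real) U.
        continuous_on UNIV f \<and> bounded (range f) \<and> open U}"
  then obtain h :: "'b \<Rightarrow> real" and U
    where V: "V = {\<mu> \<in> space (prob_algebra borel). (\<integral>x. h x \<partial>\<mu>) \<in> U}"
      and h: "continuous_on UNIV h" "bounded (range h)" and "open U" by blast
  obtain f :: "'a \<Rightarrow> real" where f: "continuous_on UNIV f" "bounded (range f)"
    and eq: "\<And>\<mu>. \<mu> \<in> space (prob_algebra borel) \<Longrightarrow> (\<integral>y. h y \<partial>\<Phi> \<mu>) = (\<integral>x. f x \<partial>\<mu>)"
    using assms(2)[OF h] by blast
  have "\<Phi> -` V \<inter> topspace weak_topology = {\<mu> \<in> space (prob_algebra borel). (\<integral>x. f x \<partial>\<mu>) \<in> U}"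
    using eq assms(1) by (auto simp: V topspace_weak_topology)
  also have "openin weak_topology \<dots>"
    unfolding weak_topology_def using f \<open>open U\<close> by (intro topology_generated_by_Basis) blast
  finally show "openin weak_topology (\<Phi> -` V \<inter> topspace weak_topology)" .
next
  show "\<Phi> ` topspace weak_topology \<subseteq> \<Union> {{\<mu> \<in> space (prob_algebra borel). (\<integral>x. f x \<partial>\<mu>) \<in> U} |
      (f :: 'b \<Rightarrow> real) U. continuous_on UNIV f \<and> bounded (range f) \<and> open U}"
    using assms(1) topspace_weak_topology[where ?'a = 'b, unfolded weak_topology_def topology_generated_by_topspace]
    by (auto simp: topspace_weak_topology)
qed

lemma space_weak_borel: "space weak_borel = space (prob_algebra borel)"
  by (simp add: weak_borel_def space_measure_of_conv)

lemma sets_weak_borel: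
  "sets weak_borel = sigma_sets (space (prob_algebra borel)) {U. openin weak_topology U}"
  unfolding weak_borel_def
  by (intro sets_measure_of) (use openin_subset topspace_weak_topology in blast)

lemma measurable_weak_borel_continuous_map:
  assumes "continuous_map weak_topology weak_topology \<Phi>"
  shows "\<Phi> \<in> weak_borel \<rightarrow>\<^sub>M weak_borel"
proof (rule measurable_sigma_sets[OF sets_weak_borel])
  show "{U. openin weak_topology U} \<subseteq> Pow (space (prob_algebra borel))"
    using openin_subset topspace_weak_topology by blast
  show "\<Phi> \<in> space weak_borel \<rightarrow> space (prob_algebra borel)"
    using assms by (auto simp: space_weak_borel continuous_map topspace_weak_topology)
  show "\<Phi> -` U \<inter> space weak_borel \<in> sets weak_borel" if "U \<in> {U. openin weak_topology U}" for U
  proof -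
    have "\<Phi> -` U \<inter> space weak_borel = {x \<in> topspace weak_topology. \<Phi> x \<in> U}"
      by (auto simp: space_weak_borel topspace_weak_topology)
    with openin_continuous_map_preimage[OF assms] that show ?thesis
      unfolding sets_weak_borel by auto
  qed
qed

text \<open>Turns the candidate limits into random measures. As \<open>weak_borel\<close> is
  generated by the weakly open sets, continuity suffices and no comparison with the evaluation maps
  \<mu> \<mapsto> \<mu>(A) is made.\<close>

lemma random_measure_continuous_image:
  assumes "random_measure M P" "continuous_map weak_topology weak_topology \<Phi>"
  shows "random_measure M (\<lambda>\<omega>. \<Phi> (P \<omega>))"
  using measurable_compose[OF _ measurable_weak_borel_continuous_map] assms
  unfolding random_measure_def by blast

lemma random_measure_in_space:
  assumes "random_measure M P" "\<omega> \<in> space M"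
  shows "P \<omega> \<in> space (prob_algebra borel)"
  using measurable_space[OF assms(1)[unfolded random_measure_def] assms(2)]
  by (simp add: space_weak_borel)

text \<open>The passage between a metric and the topology that it induces; through it
  \<open>dX\<close> and \<open>dZ\<close> can be handled together.\<close>

lemma metrizes_weak_convergence_limitin:
  assumes "metrizes_weak_convergence d" "\<mu> \<in> space (prob_algebra borel)"
    "\<forall>\<^sub>F n in F. m n \<in> space (prob_algebra borel)"
  shows "limitin weak_topology m \<mu> F \<longleftrightarrow> ((\<lambda>n. d (m n) \<mu>) \<longlongrightarrow> 0) F"
proof -
  interpret Metric_space "space (prob_algebra borel)" d
    using assms(1) by (simp add: metrizes_weak_convergence_def)
  have "mtopology = weak_topology"
    using assms(1) by (simp add: metrizes_weak_convergence_def)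
  then show ?thesis
    using limitin_metric_dist_null[of m \<mu> F] assms by simp
qed

section \<open>Empirical measures and the measurability of their distance to a random
  measure\<close>

lemma empirical_measure_cong:
  assumes "\<And>i. i \<in> {1..n} \<Longrightarrow> x i = y i"
  shows "empirical_measure x n = empirical_measure y n"
  using assms unfolding empirical_measure_def by (intro arg_cong[where f="measure_of _ _"]) auto

text \<open>The empirical measure is the law of \<open>x\<close> at a uniformly chosen index, so
  integrals and marginals reduce to the change of variables for \<open>distr\<close>. The bound on
  \<open>n\<close> keeps the index set nonempty.\<close>

lemma empirical_measure_eq_distr:
  fixes x :: "nat \<Rightarrow> 'a::topological_space"
  assumes "n \<ge> 1"
  shows "empirical_measure x n = distr (measure_pmf (pmf_of_set {1..n})) borel x"
proof (rule measure_eqI)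
  fix A assume "A \<in> sets (empirical_measure x n)"
  then have A: "A \<in> sets borel" by simp
  have "emeasure (empirical_measure x n) A = ennreal (1 / real n) * (\<Sum>i=1..n. indicator A (x i))"
    using A by (simp add: emeasure_empirical_measure)
  also have "(\<Sum>i=1..n. indicator A (x i)) = (\<Sum>i=1..n. ennreal (indicator (x -` A) i))"
    by (intro sum.cong) (auto simp: indicator_def)
  also have "\<dots> = ennreal (\<Sum>i=1..n. indicator (x -` A) i)"
    by (intro sum_ennreal) auto
  also have "(\<Sum>i=1..n. indicator (x -` A) i) = real (card ({1..n} \<inter> x -` A))"
    by (simp add: indicator_def vimage_def)
  also have "ennreal (1 / real n) * ennreal (real (card ({1..n} \<inter> x -` A)))
      = ennreal (real (card ({1..n} \<inter> x -` A)) / real n)"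
    by (subst ennreal_mult[symmetric]) auto
  also have "\<dots> = emeasure (distr (measure_pmf (pmf_of_set {1..n})) borel x) A"
    using A assms by (simp add: emeasure_distr emeasure_pmf_of_set)
  finally show "emeasure (empirical_measure x n) A
      = emeasure (distr (measure_pmf (pmf_of_set {1..n})) borel x) A" .
qed simp

lemma integral_empirical_measure:
  fixes f :: "'a::topological_space \<Rightarrow> real"
  assumes "n \<ge> 1" "f \<in> borel_measurable borel"
  shows "(\<integral>x. f x \<partial>empirical_measure x n) = (\<Sum>i=1..n. f (x i)) / real n"
  using assms by (simp add: empirical_measure_eq_distr integral_distr integral_pmf_of_set)

lemma limitin_empirical_measure:
  fixes x :: "nat \<Rightarrow> 'a::{metric_space, second_countable_topology}"
  assumes "n \<ge> 1" "\<And>i. i \<in> {1..n} \<Longrightarrow> (\<lambda>m. y m i) \<longlonglongrightarrow> x i"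
  shows "limitin weak_topology (\<lambda>m. empirical_measure (y m) n) (empirical_measure x n) sequentially"
proof -
  have "(\<lambda>m. (\<Sum>i=1..n. f (y m i)) / real n) \<longlonglongrightarrow> (\<Sum>i=1..n. f (x i)) / real n"
    if "continuous_on UNIV f" for f :: "'a \<Rightarrow> real"
    using that assms by (intro tendsto_intros continuous_on_tendsto_compose[OF that]) auto
  with assms(1) show ?thesis
    by (auto simp: limitin_weak_topology empirical_measure_in_prob_algebra integral_empirical_measure
        borel_measurable_continuous_onI)
qed

text \<open>The restriction matters: a tuple of infinitely many simple functions can take infinitely
  many values. The finite tuple is built one coordinate at a time, since a binary operation on
  simple functions gives a simple function.\<close>

lemma simple_function_restrict_process:
  fixes n :: nat
  assumes "\<And>i. i \<in> {1..n} \<Longrightarrow> simple_function M (s i)"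
  shows "simple_function M (\<lambda>\<omega>. restrict (\<lambda>i. s i \<omega>) {1..n})"
  using assms
proof (induction n)
  case (Suc n)
  have "simple_function M (\<lambda>\<omega>. (restrict (\<lambda>i. s i \<omega>) {1..n}) (Suc n := s (Suc n) \<omega>))"
    by (rule simple_function_compose2[where h="\<lambda>f a. f(Suc n := a)", OF Suc.IH[OF Suc.prems] Suc.prems]) auto
  moreover have "restrict (\<lambda>i. s i \<omega>) {1..Suc n} = (restrict (\<lambda>i. s i \<omega>) {1..n}) (Suc n := s (Suc n) \<omega>)" for \<omega>
    by (auto simp: restrict_def fun_eq_iff)
  ultimately show ?case by (simp only:)
qed (simp add: restrict_def)

text \<open>Approximating the process by simple functions avoids the measurability of \<open>d\<close> on the product
  of the spaces of measures, hence the second countability of the weak topology.\<close>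

lemma borel_measurable_dist_empirical_measure:
  fixes X :: "nat \<Rightarrow> 'w \<Rightarrow> 'a::{metric_space, second_countable_topology}"
  assumes d: "metrizes_weak_convergence d" and "n \<ge> 1"
    and X: "\<And>i. i \<ge> 1 \<Longrightarrow> X i \<in> M \<rightarrow>\<^sub>M borel" and P: "random_measure M P"
  shows "(\<lambda>\<omega>. d (empirical_measure (\<lambda>i. X i \<omega>) n) (P \<omega>)) \<in> borel_measurable M"
proof -
  interpret Metric_space "space (prob_algebra (borel :: 'a measure))" d
    using d by (simp add: metrizes_weak_convergence_def)
  have mtop: "mtopology = weak_topology"
    using d by (simp add: metrizes_weak_convergence_def)
  let ?\<P> = "space (prob_algebra (borel :: 'a measure))"
  have emp: "empirical_measure x n \<in> ?\<P>" for x :: "nat \<Rightarrow> 'a"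
    using \<open>n \<ge> 1\<close> by (rule empirical_measure_in_prob_algebra)
  have meas: "(\<lambda>\<omega>. d \<nu> (P \<omega>)) \<in> borel_measurable M" if "\<nu> \<in> ?\<P>" for \<nu>
  proof -
    have "(\<lambda>\<mu>. d \<nu> \<mu>) \<in> borel_measurable weak_borel"
    proof (rule borel_measurableI_less)
      fix c
      have "{\<mu> \<in> space weak_borel. d \<nu> \<mu> < c} = mball \<nu> c"
        using that by (auto simp: space_weak_borel)
      moreover have "openin weak_topology (mball \<nu> c)"
        using openin_mball mtop by metis
      ultimately show "{\<mu> \<in> space weak_borel. d \<nu> \<mu> < c} \<in> sets weak_borel"
        unfolding sets_weak_borel by auto
    qed
    then show ?thesis
      by (rule measurable_compose[OF P[unfolded random_measure_def]])
  qed
  have "\<exists>s. (\<forall>m. simple_function M (s m)) \<and> (\<forall>\<omega>\<in>space M. (\<lambda>m. s m \<omega>) \<longlonglongrightarrow> X i \<omega>)" if "i \<ge> 1" for i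
    using borel_measurable_implies_sequence_metric[OF X[OF that]] by blast
  then have "\<forall>i. \<exists>s. i \<ge> 1 \<longrightarrow>
      (\<forall>m. simple_function M (s m)) \<and> (\<forall>\<omega>\<in>space M. (\<lambda>m. s m \<omega>) \<longlonglongrightarrow> X i \<omega>)"
    by blast
  from choice[OF this] obtain s where s: "\<And>i m. i \<ge> 1 \<Longrightarrow> simple_function M (s i m)"
    "\<And>i \<omega>. i \<ge> 1 \<Longrightarrow> \<omega> \<in> space M \<Longrightarrow> (\<lambda>m. s i m \<omega>) \<longlonglongrightarrow> X i \<omega>"
    by blast
  define E where "E m \<omega> = empirical_measure (\<lambda>i. s i m \<omega>) n" for m \<omega>
  have simple: "simple_function M (E m)" for m
  proof -
    have "simple_function M (\<lambda>\<omega>. empirical_measure (restrict (\<lambda>i. s i m \<omega>) {1..n}) n)"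
      by (rule simple_function_compose1[where g="\<lambda>x. empirical_measure x n",
            OF simple_function_restrict_process]) (use s(1) in auto)
    moreover have "empirical_measure (restrict (\<lambda>i. s i m \<omega>) {1..n}) n = E m \<omega>" for \<omega>
      unfolding E_def by (intro empirical_measure_cong) auto
    ultimately show ?thesis by simp
  qed
  show ?thesis
  proof (rule borel_measurable_LIMSEQ_real)
    \<comment> \<open>\<open>E m\<close> has finitely many values, so the first argument of
      \<open>d\<close> can be frozen at each of them, and \<open>meas\<close> handles the remaining
      argument.\<close>
    show "(\<lambda>\<omega>. d (E m \<omega>) (P \<omega>)) \<in> borel_measurable M" for m
    proof (rule measurable_compose_countable'[where I="E m ` space M" and f="\<lambda>\<nu> \<omega>. d \<nu> (P \<omega>)"])
      show "(\<lambda>\<omega>. d \<nu> (P \<omega>)) \<in> borel_measurable M" if "\<nu> \<in> E m ` space M" for \<nu>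
        using that meas emp by (auto simp: E_def)
      show "countable (E m ` space M)"
        using simple by (auto simp: simple_function_def countable_finite)
      show "E m \<in> M \<rightarrow>\<^sub>M count_space (E m ` space M)"
        using measurable_simple_function[OF simple]
        by (auto simp: measurable_count_space_eq2_countable measurable_def)
    qed
    fix \<omega> assume \<omega>: "\<omega> \<in> space M"
    let ?e = "empirical_measure (\<lambda>i. X i \<omega>) n"
    have "limitin weak_topology (\<lambda>m. E m \<omega>) ?e sequentially"
      unfolding E_def using \<open>n \<ge> 1\<close> s(2) \<omega> by (intro limitin_empirical_measure) auto
    then have lim: "(\<lambda>m. d (E m \<omega>) ?e) \<longlonglongrightarrow> 0"
      using metrizes_weak_convergence_limitin[OF d emp, where m="\<lambda>m. E m \<omega>"] emp by (simp add: E_def)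
    show "(\<lambda>m. d (E m \<omega>) (P \<omega>)) \<longlonglongrightarrow> d ?e (P \<omega>)"
    proof (rule LIM_zero_cancel, rule Lim_null_comparison[OF _ lim], intro always_eventually allI)
      have in_P: "P \<omega> \<in> ?\<P>" using P \<omega> by (rule random_measure_in_space)
      show "norm (d (E m \<omega>) (P \<omega>) - d ?e (P \<omega>)) \<le> d (E m \<omega>) ?e" for m
        using triangle[of "E m \<omega>" ?e "P \<omega>"] triangle[of ?e "E m \<omega>" "P \<omega>"]
          commute[of "E m \<omega>" ?e] emp in_P by (simp add: E_def)
    qed
  qed
qed

section \<open>Laws of large numbers\<close>

text \<open>Between consecutive squares \<open>k\<^sup>2\<close> and \<open>(k + 1)\<^sup>2\<close>
  at most 2k further terms enter. They add at most 2kC to the sum, hence at most 2C/k to an average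
  over n \<ge> \<open>k\<^sup>2\<close> terms; this is the second summand of
  \<open>g\<close>.\<close>

lemma average_tendsto_0_of_squares:
  fixes a :: "nat \<Rightarrow> real"
  assumes bound: "\<And>i. i \<ge> 1 \<Longrightarrow> \<bar>a i\<bar> \<le> C"
    and squares: "(\<lambda>k. (\<Sum>i=1..k\<^sup>2. a i) / real (k\<^sup>2)) \<longlonglongrightarrow> 0"
  shows "(\<lambda>n. (\<Sum>i=1..n. a i) / real n) \<longlonglongrightarrow> 0"
proof (rule Lim_null_comparison)
  define g where "g k = \<bar>(\<Sum>i=1..k\<^sup>2. a i) / real (k\<^sup>2)\<bar> + 2 * C / real k" for k
  have "g \<longlonglongrightarrow> 0"
    unfolding g_def using tendsto_add[OF tendsto_rabs_zero[OF squares] lim_const_over_n[of "2 * C"]]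
    by simp
  moreover have "filterlim floor_sqrt at_top sequentially"
    unfolding filterlim_at_top
    by (metis eventually_at_top_linorder le_floor_sqrtI)
  ultimately show "(\<lambda>n. g (floor_sqrt n)) \<longlonglongrightarrow> 0"
    by (rule filterlim_compose)
  have "norm ((\<Sum>i=1..n. a i) / real n) \<le> g (floor_sqrt n)" if "n \<ge> 1" for n
  proof -
    define k where "k = floor_sqrt n"
    have "k \<ge> 1" using that unfolding k_def by (simp add: Suc_leI)
    have "k\<^sup>2 \<le> n" unfolding k_def by simp
    have "n < (k + 1)\<^sup>2" unfolding k_def using Suc_floor_sqrt_power2_gt[of n] by simp
    then have "n - k\<^sup>2 \<le> 2 * k" by (simp add: power2_eq_square)
    have "C \<ge> 0" using bound[of 1] by simp
    have split: "{1..n} = {1..k\<^sup>2} \<union> {k\<^sup>2<..n}" using \<open>k\<^sup>2 \<le> n\<close> by auto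
    have "(\<Sum>i=1..n. a i) = (\<Sum>i=1..k\<^sup>2. a i) + (\<Sum>i\<in>{k\<^sup>2<..n}. a i)"
      unfolding split by (intro sum.union_disjoint) auto
    also have "\<bar>\<dots>\<bar> \<le> \<bar>\<Sum>i=1..k\<^sup>2. a i\<bar> + (\<Sum>i\<in>{k\<^sup>2<..n}. \<bar>a i\<bar>)"
      by (intro order_trans[OF abs_triangle_ineq] add_left_mono sum_abs)
    also have "(\<Sum>i\<in>{k\<^sup>2<..n}. \<bar>a i\<bar>) \<le> (\<Sum>i\<in>{k\<^sup>2<..n}. C)"
      by (intro sum_mono bound) auto
    also have "\<dots> \<le> real (2 * k) * C"
      using \<open>n - k\<^sup>2 \<le> 2 * k\<close> \<open>C \<ge> 0\<close> by (simp del: of_nat_mult add: mult_right_mono)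
    finally have "\<bar>\<Sum>i=1..n. a i\<bar> / real n \<le> (\<bar>\<Sum>i=1..k\<^sup>2. a i\<bar> + real (2 * k) * C) / real n"
      by (intro divide_right_mono) auto
    also have "\<dots> \<le> (\<bar>\<Sum>i=1..k\<^sup>2. a i\<bar> + real (2 * k) * C) / real (k\<^sup>2)"
      using \<open>k\<^sup>2 \<le> n\<close> \<open>k \<ge> 1\<close> \<open>C \<ge> 0\<close> that
      by (intro divide_left_mono mult_pos_pos) (auto simp del: of_nat_power)
    also have "\<dots> = g k"
      using \<open>k \<ge> 1\<close> by (simp add: g_def field_simps power2_eq_square)
    finally show ?thesis by (simp add: k_def)
  qed
  then show "\<forall>\<^sub>F n in sequentially. norm ((\<Sum>i=1..n. a i) / real n) \<le> g (floor_sqrt n)"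
    using eventually_ge_at_top by (rule eventually_mono[rotated])
qed

text \<open>By orthogonality the averages along the squares have summable second moments.\<close>

lemma (in prob_space) strong_law_bounded_orthogonal:
  fixes D :: "nat \<Rightarrow> 'a \<Rightarrow> real"
  assumes meas: "\<And>i. i \<ge> 1 \<Longrightarrow> D i \<in> borel_measurable M"
    and bound: "\<And>i \<omega>. i \<ge> 1 \<Longrightarrow> \<omega> \<in> space M \<Longrightarrow> \<bar>D i \<omega>\<bar> \<le> C"
    and orth: "\<And>i j. 1 \<le> i \<Longrightarrow> i < j \<Longrightarrow> (\<integral>\<omega>. D i \<omega> * D j \<omega> \<partial>M) = 0"
  shows "AE \<omega> in M. (\<lambda>n. (\<Sum>i=1..n. D i \<omega>) / real n) \<longlonglongrightarrow> 0"
proof -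
  define S where "S n \<omega> = (\<Sum>i=1..n. D i \<omega>)" for n \<omega>
  have meas_S [measurable]: "S n \<in> borel_measurable M" for n
    unfolding S_def using meas by (intro borel_measurable_sum) auto
  have integrable_prod: "integrable M (\<lambda>\<omega>. D i \<omega> * D j \<omega>)" if "i \<ge> 1" "j \<ge> 1" for i j
  proof (rule integrable_const_bound[where B="C * C"])
    show "AE \<omega> in M. norm (D i \<omega> * D j \<omega>) \<le> C * C"
      using that bound by (intro AE_I2) (auto simp: abs_mult intro!: mult_mono order_trans[OF abs_ge_zero])
    show "(\<lambda>\<omega>. D i \<omega> * D j \<omega>) \<in> borel_measurable M"
      using that meas by (intro borel_measurable_times) auto
  qed
  have S_sq: "(S n \<omega>)\<^sup>2 = (\<Sum>i=1..n. \<Sum>j=1..n. D i \<omega> * D j \<omega>)" for n \<omega>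
    by (simp add: S_def power2_eq_square sum_product)
  have integrable_S_sq: "integrable M (\<lambda>\<omega>. (S n \<omega>)\<^sup>2)" for n
    unfolding S_sq by (intro Bochner_Integration.integrable_sum integrable_prod) auto
  \<comment> \<open>Off the diagonal the expectation vanishes by \<open>orth\<close>, after
    exchanging the factors if j < i, so the double sum for the second moment of \<open>S n\<close>
    collapses to its n diagonal terms.\<close>
  have prod_le: "(\<integral>\<omega>. D i \<omega> * D j \<omega> \<partial>M) \<le> (if i = j then C\<^sup>2 else 0)" if "i \<ge> 1" "j \<ge> 1" for i j
  proof (cases "i = j")
    case True
    have "(\<integral>\<omega>. D i \<omega> * D i \<omega> \<partial>M) \<le> (\<integral>\<omega>. C\<^sup>2 \<partial>M)"
      using that bound
      by (intro integral_mono integrable_prod)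
        (auto simp: power2_eq_square abs_mult[symmetric] intro!: abs_le_square_iff[THEN iffD1, unfolded power2_eq_square] intro: order_trans[OF _ abs_ge_self])
    then show ?thesis using True by (simp add: prob_space)
  next
    case False
    then show ?thesis
      using that orth[of i j] orth[of j i] by (cases "i < j") (auto simp: mult.commute)
  qed
  have second_moment: "(\<integral>\<omega>. (S n \<omega>)\<^sup>2 \<partial>M) \<le> real n * C\<^sup>2" for n
  proof -
    have "(\<integral>\<omega>. (S n \<omega>)\<^sup>2 \<partial>M) = (\<Sum>i=1..n. \<Sum>j=1..n. \<integral>\<omega>. D i \<omega> * D j \<omega> \<partial>M)"
      unfolding S_sq
      by (subst Bochner_Integration.integral_sum, intro Bochner_Integration.integrable_sum integrable_prod,
          simp, simp, intro sum.cong refl Bochner_Integration.integral_sum integrable_prod) auto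
    also have "\<dots> \<le> (\<Sum>i=1..n. \<Sum>j=1..n. if i = j then C\<^sup>2 else 0)"
      by (intro sum_mono prod_le) auto
    also have "\<dots> = real n * C\<^sup>2"
      by simp
    finally show ?thesis .
  qed
  \<comment> \<open>The shift to \<open>Suc k\<close> keeps the denominator positive. By
    \<open>second_moment\<close> the expectation of \<open>u k\<close> is at most
    \<open>C\<^sup>2 / (Suc k)\<^sup>2\<close>, so the series of the \<open>u k\<close> has finite
    expectation. It therefore converges almost surely, and its terms tend to 0.\<close>
  define u where "u k \<omega> = (S ((Suc k)\<^sup>2) \<omega> / real ((Suc k)\<^sup>2))\<^sup>2" for k \<omega>
  have meas_u [measurable]: "u k \<in> borel_measurable M" for k
    unfolding u_def by measurable
  have "(\<integral>\<^sup>+\<omega>. (\<Sum>k. ennreal (u k \<omega>)) \<partial>M) = (\<Sum>k. \<integral>\<^sup>+\<omega>. ennreal (u k \<omega>) \<partial>M)"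
    by (rule nn_integral_suminf) measurable
  also have "\<dots> \<le> (\<Sum>k. ennreal (C\<^sup>2 * (1 / real (Suc k) ^ 2)))"
  proof (intro suminf_le summableI)
    fix k
    have "(\<integral>\<^sup>+\<omega>. ennreal (u k \<omega>) \<partial>M) = ennreal (\<integral>\<omega>. u k \<omega> \<partial>M)"
      unfolding u_def power_divide
      by (intro nn_integral_eq_integral integrable_divide integrable_S_sq) auto
    also have "(\<integral>\<omega>. u k \<omega> \<partial>M) = (\<integral>\<omega>. (S ((Suc k)\<^sup>2) \<omega>)\<^sup>2 \<partial>M) / (real ((Suc k)\<^sup>2))\<^sup>2"
      unfolding u_def power_divide by simp
    also have "\<dots> \<le> real ((Suc k)\<^sup>2) * C\<^sup>2 / (real ((Suc k)\<^sup>2))\<^sup>2"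
      by (intro divide_right_mono second_moment) simp
    also have "\<dots> = C\<^sup>2 * (1 / real (Suc k) ^ 2)"
      by (simp only: of_nat_power) (simp add: power2_eq_square del: of_nat_Suc)
    finally show "(\<integral>\<^sup>+\<omega>. ennreal (u k \<omega>) \<partial>M) \<le> ennreal (C\<^sup>2 * (1 / real (Suc k) ^ 2))"
      by (simp add: ennreal_leI)
  qed
  also have "\<dots> < \<infinity>"
  proof -
    have "summable (\<lambda>k. 1 / real k ^ 2)"
      using inverse_power_summable[of 2, where 'a = real] by (simp add: inverse_eq_divide)
    then have "summable (\<lambda>k. C\<^sup>2 * (1 / real (Suc k) ^ 2))"
      by (intro summable_mult summable_Suc_iff[THEN iffD2, where f1="\<lambda>k. 1 / real k ^ 2"])
    then show ?thesis
      by (subst suminf_ennreal2) auto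
  qed
  finally have "AE \<omega> in M. (\<Sum>k. ennreal (u k \<omega>)) \<noteq> \<infinity>"
    by (intro nn_integral_PInf_AE) auto
  with AE_space show ?thesis
  proof eventually_elim
    case (elim \<omega>)
    have "summable (\<lambda>k. u k \<omega>)"
      using elim by (intro summable_suminf_not_top) (auto simp: u_def)
    then have "(\<lambda>k. sqrt (u k \<omega>)) \<longlonglongrightarrow> sqrt 0"
      by (intro tendsto_real_sqrt summable_LIMSEQ_zero)
    then have "(\<lambda>k. S ((Suc k)\<^sup>2) \<omega> / real ((Suc k)\<^sup>2)) \<longlonglongrightarrow> 0"
      unfolding u_def real_sqrt_abs by (subst (asm) real_sqrt_zero) (rule tendsto_rabs_zero_cancel)
    then have "(\<lambda>k. S (k\<^sup>2) \<omega> / real (k\<^sup>2)) \<longlonglongrightarrow> 0"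
      by (rule LIMSEQ_imp_Suc)
    then show ?case
      unfolding S_def using bound elim by (intro average_tendsto_0_of_squares) auto
  qed
qed

section \<open>Markov kernels and expectations conditional on the past\<close>

lemma measurable_markov_kernel:
  assumes "markov_kernel p"
  shows "p \<in> borel \<rightarrow>\<^sub>M prob_algebra borel"
proof (rule measurable_prob_algebraI)
  have p: "sets (p x) = sets borel" "prob_space (p x)" for x
    using assms by (auto simp: markov_kernel_def)
  then show "prob_space (p x)" for x by blast
  \<comment> \<open>Setwise measurability becomes measurability into a space of measures, the form
    in which a kernel can be composed by \<open>bind\<close>.\<close>
  show "p \<in> borel \<rightarrow>\<^sub>M subprob_algebra borel"
  proof (rule measurable_subprob_algebra)
    show "subprob_space (p x)" for x
      using p by (intro prob_space_imp_subprob_space)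
    fix B :: "'b set" assume "B \<in> sets borel"
    then have "(\<lambda>x. ennreal (measure (p x) B)) \<in> borel_measurable borel"
      using assms by (auto simp: markov_kernel_def)
    moreover have "emeasure (p x) B = ennreal (measure (p x) B)" for x
      using p by (intro finite_measure.emeasure_eq_measure prob_space.finite_measure)
    ultimately show "(\<lambda>x. emeasure (p x) B) \<in> borel_measurable borel"
      by simp
  qed (use p in auto)
qed

lemma (in prob_space) integral_in_bounds:
  fixes g :: "'a \<Rightarrow> real"
  assumes "g \<in> borel_measurable M" "\<And>x. \<bar>g x\<bar> \<le> B"
  shows "integrable M g" and "\<bar>\<integral>x. g x \<partial>M\<bar> \<le> B"
proof -
  show "integrable M g"
    using assms by (intro integrable_const_bound[where B=B]) auto
  then have "\<bar>\<integral>x. g x \<partial>M\<bar> \<le> (\<integral>x. B \<partial>M)"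
    using assms by (intro order_trans[OF integral_abs_bound] integral_mono) auto
  then show "\<bar>\<integral>x. g x \<partial>M\<bar> \<le> B"
    by (simp add: prob_space)
qed

lemma markov_kernel_integral_bound:
  fixes g :: "'b::topological_space \<Rightarrow> real"
  assumes "markov_kernel p" "g \<in> borel_measurable borel" "\<And>y. \<bar>g y\<bar> \<le> B"
  shows "\<bar>\<integral>y. g y \<partial>p x\<bar> \<le> B" and "integrable (p x) g"
proof -
  have p: "sets (p x) = sets borel" "prob_space (p x)"
    using assms(1) by (auto simp: markov_kernel_def)
  have "g \<in> borel_measurable (p x)"
    using assms(2) measurable_cong_sets[OF p(1) refl] by blast
  with p assms(3) show "\<bar>\<integral>y. g y \<partial>p x\<bar> \<le> B" "integrable (p x) g"
    by (auto intro: prob_space.integral_in_bounds)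
qed

lemma borel_measurable_markov_kernel_integral:
  fixes g :: "'b::topological_space \<Rightarrow> real"
  assumes "markov_kernel p" "g \<in> borel_measurable borel"
  shows "(\<lambda>x. \<integral>y. g y \<partial>p x) \<in> borel_measurable borel"
  using measurable_compose[OF measurable_prob_algebraD[OF measurable_markov_kernel[OF assms(1)]]
      integral_measurable_subprob_algebra[OF assms(2)]] .

lemma space_past_algebra [simp]: "space (past_algebra M X Y n) = space M"
  unfolding past_algebra_def by (rule space_measure_of) auto

lemma sets_past_algebra:
  "sets (past_algebra M X Y n) = sigma_sets (space M)
     ((\<Union>i\<in>{1..n}. {X i -` A \<inter> space M | A. A \<in> sets borel}) \<union>
      (\<Union>i\<in>{1..<n}. {Y i -` B \<inter> space M | B. B \<in> sets borel}))"
  unfolding past_algebra_def by (rule sets_measure_of) auto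

lemma measurable_past_algebra:
  fixes X :: "nat \<Rightarrow> 'w \<Rightarrow> 'x::topological_space" and Y :: "nat \<Rightarrow> 'w \<Rightarrow> 'y::topological_space"
  shows "i \<in> {1..n} \<Longrightarrow> X i \<in> past_algebra M X Y n \<rightarrow>\<^sub>M borel"
    and "i \<in> {1..<n} \<Longrightarrow> Y i \<in> past_algebra M X Y n \<rightarrow>\<^sub>M borel"
proof -
  show "X i \<in> past_algebra M X Y n \<rightarrow>\<^sub>M borel" if "i \<in> {1..n}"
  proof (rule measurableI)
    fix A :: "'x set" assume "A \<in> sets borel"
    then have "X i -` A \<inter> space M \<in> (\<Union>i\<in>{1..n}. {X i -` A \<inter> space M | A. A \<in> sets borel})"
      using that by blast
    then show "X i -` A \<inter> space (past_algebra M X Y n) \<in> sets (past_algebra M X Y n)"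
      unfolding sets_past_algebra space_past_algebra by (intro sigma_sets.Basic UnI1)
  qed simp
  show "Y i \<in> past_algebra M X Y n \<rightarrow>\<^sub>M borel" if "i \<in> {1..<n}"
  proof (rule measurableI)
    fix B :: "'y set" assume "B \<in> sets borel"
    then have "Y i -` B \<inter> space M \<in> (\<Union>i\<in>{1..<n}. {Y i -` B \<inter> space M | B. B \<in> sets borel})"
      using that by blast
    then show "Y i -` B \<inter> space (past_algebra M X Y n) \<in> sets (past_algebra M X Y n)"
      unfolding sets_past_algebra space_past_algebra by (intro sigma_sets.Basic UnI2)
  qed simp
qed

lemma subalgebra_past_algebra:
  assumes "\<And>i. i \<ge> 1 \<Longrightarrow> X i \<in> M \<rightarrow>\<^sub>M borel" "\<And>i. i \<ge> 1 \<Longrightarrow> Y i \<in> M \<rightarrow>\<^sub>M borel"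
  shows "subalgebra M (past_algebra M X Y n)"
proof -
  have "(\<Union>i\<in>{1..n}. {X i -` A \<inter> space M | A. A \<in> sets borel}) \<union>
      (\<Union>i\<in>{1..<n}. {Y i -` B \<inter> space M | B. B \<in> sets borel}) \<subseteq> sets M"
    using measurable_sets[OF assms(1)] measurable_sets[OF assms(2)] by auto
  then show ?thesis
    by (simp add: subalgebra_def sets_past_algebra sets.sigma_sets_subset)
qed

text \<open>Both sides are integrals of \<open>g\<close>, against the law of \<open>Y n\<close> under the measure with density
  \<open>W\<close> and against the corresponding mixture of the kernel; these two measures agree on Borel sets
  by the defining property of the conditional distribution.\<close>

lemma (in prob_space) transition_pairs_expectation_nonneg:
  fixes X :: "nat \<Rightarrow> 'a \<Rightarrow> 'x::topological_space" and Y :: "nat \<Rightarrow> 'a \<Rightarrow> 'y::topological_space"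
    and g :: "'y \<Rightarrow> real"
  assumes p: "markov_kernel p" and XY: "transition_pairs M p X Y" and n: "n \<ge> 1"
    and W: "W \<in> borel_measurable (past_algebra M X Y n)" "\<And>\<omega>. 0 \<le> W \<omega>" "\<And>\<omega>. W \<omega> \<le> C"
    and g: "g \<in> borel_measurable borel" "\<And>y. \<bar>g y\<bar> \<le> B"
  shows "(\<integral>\<omega>. W \<omega> * g (Y n \<omega>) \<partial>M) = (\<integral>\<omega>. W \<omega> * (\<integral>y. g y \<partial>p (X n \<omega>)) \<partial>M)"
proof -
  let ?F = "past_algebra M X Y n"
  have X: "i \<ge> 1 \<Longrightarrow> X i \<in> M \<rightarrow>\<^sub>M borel" and Y: "i \<ge> 1 \<Longrightarrow> Y i \<in> M \<rightarrow>\<^sub>M borel" for i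
    using XY by (auto simp: transition_pairs_def)
  note [measurable] = X[OF n] Y[OF n] g(1)
  obtain \<kappa> where \<kappa>: "regular_cond_distribution M ?F (Y n) \<kappa>" "AE \<omega> in M. \<kappa> \<omega> = p (X n \<omega>)"
    using XY n by (auto simp: transition_pairs_def AE_all_countable elim!: eventually_mono)
  interpret sub: finite_measure_subalgebra M ?F
    by (intro finite_measure_subalgebra.intro finite_measure_axioms
        finite_measure_subalgebra_axioms.intro subalgebra_past_algebra X Y)
  have [measurable]: "W \<in> borel_measurable M"
    by (rule measurable_from_subalg[OF sub.subalg W(1)])
  have ps: "sets (p x) = sets borel" "prob_space (p x)" for x
    using p by (auto simp: markov_kernel_def)
  define N where "N = (\<lambda>\<omega>. p (X n \<omega>))"
  have N: "N \<in> M \<rightarrow>\<^sub>M subprob_algebra borel"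
    unfolding N_def
    using measurable_compose[OF X[OF n] measurable_prob_algebraD[OF measurable_markov_kernel[OF p]]] .
  \<comment> \<open>Absorbing the weight into the measure turns the claim into an equality of two
    measures. A density has to be nonnegative, hence the sign condition on \<open>W\<close>.\<close>
  define L where "L = density M (\<lambda>\<omega>. ennreal (W \<omega>))"
  have sets_L [simp]: "sets L = sets M" "space L = space M"
    by (simp_all add: L_def)
  have N_L: "N \<in> L \<rightarrow>\<^sub>M subprob_algebra borel"
    using N measurable_cong_sets[OF sets_L(1) refl] by blast
  have Y_L [measurable]: "Y n \<in> L \<rightarrow>\<^sub>M borel"
    using Y[OF n] measurable_cong_sets[OF sets_L(1) refl] by blast
  have "distr L borel (Y n) = L \<bind> N"
  proof (rule measure_eqI)
    show "sets (distr L borel (Y n)) = sets (L \<bind> N)"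
      using sets_bind[of L N borel] N_L not_empty by (simp add: sets_kernel)
    fix A assume "A \<in> sets (distr L borel (Y n))"
    then have A [measurable]: "A \<in> sets borel" by simp
    have ind: "(\<lambda>\<omega>. indicator (Y n -` A \<inter> space M) \<omega> :: real) \<in> borel_measurable M"
      by measurable
    have int1: "integrable M (\<lambda>\<omega>. W \<omega> * indicator (Y n -` A \<inter> space M) \<omega>)"
      using W by (intro integrable_const_bound[where B=C]) (auto simp: indicator_def order_trans[OF W(2) W(3)])
    have int2: "integrable M (\<lambda>\<omega>. W \<omega> * measure (p (X n \<omega>)) A)"
    proof (rule integrable_const_bound[where B=C])
      show "AE \<omega> in M. norm (W \<omega> * measure (p (X n \<omega>)) A) \<le> C"
        using W ps(2) by (intro AE_I2)
          (auto simp: abs_mult intro!: mult_left_le[THEN order_trans] prob_space.prob_le_1)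
      have "(\<lambda>x. measure (p x) A) \<in> borel_measurable borel"
        using p A by (auto simp: markov_kernel_def)
      from measurable_compose[OF X[OF n] this]
      show "(\<lambda>\<omega>. W \<omega> * measure (p (X n \<omega>)) A) \<in> borel_measurable M"
        by measurable
    qed
    have "emeasure (distr L borel (Y n)) A = (\<integral>\<^sup>+\<omega>. ennreal (W \<omega>) * indicator (Y n -` A \<inter> space M) \<omega> \<partial>M)"
      by (simp add: emeasure_distr L_def emeasure_density)
    also have "\<dots> = (\<integral>\<^sup>+\<omega>. ennreal (W \<omega> * indicator (Y n -` A \<inter> space M) \<omega>) \<partial>M)"
      by (intro nn_integral_cong) (simp add: indicator_def)
    also have "\<dots> = ennreal (\<integral>\<omega>. W \<omega> * indicator (Y n -` A \<inter> space M) \<omega> \<partial>M)"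
      using W int1 by (intro nn_integral_eq_integral) auto
    \<comment> \<open>Since \<open>W\<close> is measurable for the past, the indicator can be
      replaced by its conditional expectation under the integral; by the choice of \<kappa> the
      latter is almost surely the kernel evaluated at \<open>X n\<close>.\<close>
    also have "(\<integral>\<omega>. W \<omega> * indicator (Y n -` A \<inter> space M) \<omega> \<partial>M)
        = (\<integral>\<omega>. W \<omega> * real_cond_exp M ?F (indicator (Y n -` A \<inter> space M)) \<omega> \<partial>M)"
      using sub.real_cond_exp_intg(2)[OF int1 W(1) ind] by simp
    also have "\<dots> = (\<integral>\<omega>. W \<omega> * measure (p (X n \<omega>)) A \<partial>M)"
    proof (rule integral_cong_AE)
      have "AE \<omega> in M. measure (\<kappa> \<omega>) A = real_cond_exp M ?F (indicator (Y n -` A \<inter> space M)) \<omega>"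
        using \<kappa>(1) A by (auto simp: regular_cond_distribution_def)
      with \<kappa>(2) show "AE \<omega> in M. W \<omega> * real_cond_exp M ?F (indicator (Y n -` A \<inter> space M)) \<omega>
          = W \<omega> * measure (p (X n \<omega>)) A"
        by eventually_elim simp
    qed (use int2 in auto)
    also have "ennreal \<dots> = (\<integral>\<^sup>+\<omega>. ennreal (W \<omega> * measure (p (X n \<omega>)) A) \<partial>M)"
      using W int2 by (intro nn_integral_eq_integral[symmetric]) auto
    also have "\<dots> = (\<integral>\<^sup>+\<omega>. ennreal (W \<omega>) * emeasure (N \<omega>) A \<partial>M)"
      using W ps by (intro nn_integral_cong)
        (simp add: N_def ennreal_mult finite_measure.emeasure_eq_measure prob_space.finite_measure)
    also have "\<dots> = (\<integral>\<^sup>+\<omega>. emeasure (N \<omega>) A \<partial>L)"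
      unfolding L_def
      by (rule nn_integral_density[symmetric])
        (use measurable_emeasure_kernel[OF N A] in auto)
    also have "\<dots> = emeasure (L \<bind> N) A"
      using not_empty by (intro emeasure_bind[OF _ N_L A, symmetric]) auto
    finally show "emeasure (distr L borel (Y n)) A = emeasure (L \<bind> N) A" .
  qed
  then have "integral\<^sup>L (distr L borel (Y n)) g = integral\<^sup>L (L \<bind> N) g" by simp
  also have "\<dots> = (\<integral>\<omega>. integral\<^sup>L (N \<omega>) g \<partial>L)"
  proof (rule integral_bind[OF g(1) _ N_L, where B'=1])
    show "\<bar>g y\<bar> \<le> B" for y by (rule g(2))
    have "emeasure L (space L) = (\<integral>\<^sup>+\<omega>. ennreal (W \<omega>) \<partial>M)"
      unfolding L_def by (subst emeasure_density) auto
    also have "\<dots> \<le> (\<integral>\<^sup>+\<omega>. ennreal C \<partial>M)"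
      using W by (intro nn_integral_mono ennreal_leI)
    finally show "finite_measure L"
      by (intro finite_measureI) (auto simp: emeasure_space_1 top_unique)
    show "AE \<omega> in L. emeasure (N \<omega>) (space (N \<omega>)) \<le> ennreal 1"
      using ps by (intro AE_I2) (simp add: N_def prob_space.emeasure_space_1)
  qed
  finally have "(\<integral>\<omega>. g (Y n \<omega>) \<partial>L) = (\<integral>\<omega>. integral\<^sup>L (N \<omega>) g \<partial>L)"
    by (simp add: integral_distr)
  moreover have "(\<lambda>\<omega>. integral\<^sup>L (N \<omega>) g) \<in> borel_measurable M"
    using measurable_compose[OF N integral_measurable_subprob_algebra[OF g(1)]] .
  ultimately show ?thesis
    using W unfolding L_def by (simp add: integral_density N_def)
qed

text \<open>A signed weight is the difference of the nonnegative weights \<open>W + C\<close> and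
  \<open>C\<close>, both measurable for the past, so the claim is the difference of two nonnegative
  instances. This is the martingale difference property tested against bounded weights.\<close>

lemma (in prob_space) transition_pairs_expectation:
  fixes X :: "nat \<Rightarrow> 'a \<Rightarrow> 'x::topological_space" and Y :: "nat \<Rightarrow> 'a \<Rightarrow> 'y::topological_space"
    and g :: "'y \<Rightarrow> real"
  assumes p: "markov_kernel p" and XY: "transition_pairs M p X Y" and n: "n \<ge> 1"
    and W: "W \<in> borel_measurable (past_algebra M X Y n)" "\<And>\<omega>. \<bar>W \<omega>\<bar> \<le> C"
    and g: "g \<in> borel_measurable borel" "\<And>y. \<bar>g y\<bar> \<le> B"
  shows "(\<integral>\<omega>. W \<omega> * (g (Y n \<omega>) - (\<integral>y. g y \<partial>p (X n \<omega>))) \<partial>M) = 0"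
proof -
  let ?F = "past_algebra M X Y n"
  have X: "i \<ge> 1 \<Longrightarrow> X i \<in> M \<rightarrow>\<^sub>M borel" and Y: "i \<ge> 1 \<Longrightarrow> Y i \<in> M \<rightarrow>\<^sub>M borel" for i
    using XY by (auto simp: transition_pairs_def)
  have [measurable]: "W \<in> borel_measurable M"
    using subalgebra_past_algebra[of X M Y n] X Y W(1) by (blast intro: measurable_from_subalg)
  have [measurable]: "(\<lambda>\<omega>. g (Y n \<omega>)) \<in> borel_measurable M"
    using measurable_compose[OF Y[OF n] g(1)] .
  have [measurable]: "(\<lambda>\<omega>. \<integral>y. g y \<partial>p (X n \<omega>)) \<in> borel_measurable M"
    using measurable_compose[OF X[OF n] borel_measurable_markov_kernel_integral[OF p g(1)]] .
  have C: "0 \<le> C" and B: "0 \<le> B"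
    using order_trans[OF abs_ge_zero W(2)] order_trans[OF abs_ge_zero g(2)] by auto
  note g_p = markov_kernel_integral_bound(1)[OF p g]
  have int: "integrable M (\<lambda>\<omega>. V \<omega> * U \<omega>)"
    if "V \<in> borel_measurable M" "U \<in> borel_measurable M" "\<And>\<omega>. \<bar>V \<omega>\<bar> \<le> 2 * C" "\<And>\<omega>. \<bar>U \<omega>\<bar> \<le> B" for V U
    using that C by (intro integrable_const_bound[where B="2 * C * B"] AE_I2) (auto simp: abs_mult intro: mult_mono)
  have W_shift: "0 \<le> W \<omega> + C" "W \<omega> + C \<le> 2 * C" for \<omega> using W(2)[of \<omega>] by linarith+
  have W2: "\<bar>W \<omega>\<bar> \<le> 2 * C" for \<omega> using W(2)[of \<omega>] C by simp
  have shifted: "(\<integral>\<omega>. (W \<omega> + C) * g (Y n \<omega>) \<partial>M) = (\<integral>\<omega>. (W \<omega> + C) * (\<integral>y. g y \<partial>p (X n \<omega>)) \<partial>M)"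
    by (intro transition_pairs_expectation_nonneg[OF p XY n _ _ _ g, where C="2 * C"]
        borel_measurable_add W(1) W_shift borel_measurable_const)
  have const: "(\<integral>\<omega>. C * g (Y n \<omega>) \<partial>M) = (\<integral>\<omega>. C * (\<integral>y. g y \<partial>p (X n \<omega>)) \<partial>M)"
    using C by (intro transition_pairs_expectation_nonneg[OF p XY n _ _ _ g, where C=C]) auto
  have "(\<integral>\<omega>. W \<omega> * U \<omega> \<partial>M) = (\<integral>\<omega>. (W \<omega> + C) * U \<omega> \<partial>M) - (\<integral>\<omega>. C * U \<omega> \<partial>M)"
    if "U \<in> borel_measurable M" "\<And>\<omega>. \<bar>U \<omega>\<bar> \<le> B" for U
    using that C W2 int[of W U] int[of "\<lambda>_. C" U] by (simp add: distrib_right)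
  from this[of "\<lambda>\<omega>. g (Y n \<omega>)"] this[of "\<lambda>\<omega>. \<integral>y. g y \<partial>p (X n \<omega>)"] shifted const
  have "(\<integral>\<omega>. W \<omega> * g (Y n \<omega>) \<partial>M) = (\<integral>\<omega>. W \<omega> * (\<integral>y. g y \<partial>p (X n \<omega>)) \<partial>M)"
    using g(2) g_p by simp
  moreover have "integrable M (\<lambda>\<omega>. W \<omega> * g (Y n \<omega>))" "integrable M (\<lambda>\<omega>. W \<omega> * (\<integral>y. g y \<partial>p (X n \<omega>)))"
    using W2 g(2) g_p by (auto intro!: int)
  ultimately show ?thesis
    by (simp add: right_diff_distrib)
qed

text \<open>For i < j the product of two summands is a past-measurable weight times the centred
  variable of \<open>Y j\<close>: the weight involves \<open>X i\<close>, \<open>Y i\<close> and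
  \<open>X j\<close>, and the past of time j contains \<open>X\<close> up to j but \<open>Y\<close>
  only up to j - 1. Hence the summands are orthogonal.\<close>

lemma (in prob_space) transition_pairs_average_tendsto_0:
  fixes X :: "nat \<Rightarrow> 'a \<Rightarrow> 'x::topological_space" and Y :: "nat \<Rightarrow> 'a \<Rightarrow> 'y::topological_space"
    and f :: "'x \<Rightarrow> real" and g :: "'y \<Rightarrow> real"
  assumes p: "markov_kernel p" and XY: "transition_pairs M p X Y"
    and f: "f \<in> borel_measurable borel" "\<And>x. \<bar>f x\<bar> \<le> A"
    and g: "g \<in> borel_measurable borel" "\<And>y. \<bar>g y\<bar> \<le> B"
  shows "AE \<omega> in M. (\<lambda>n. (\<Sum>i=1..n. f (X i \<omega>) * (g (Y i \<omega>) - (\<integral>y. g y \<partial>p (X i \<omega>)))) / real n) \<longlonglongrightarrow> 0"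
proof (rule strong_law_bounded_orthogonal)
  define D where "D i \<omega> = f (X i \<omega>) * (g (Y i \<omega>) - (\<integral>y. g y \<partial>p (X i \<omega>)))" for i \<omega>
  have X: "i \<ge> 1 \<Longrightarrow> X i \<in> M \<rightarrow>\<^sub>M borel" and Y: "i \<ge> 1 \<Longrightarrow> Y i \<in> M \<rightarrow>\<^sub>M borel" for i
    using XY by (auto simp: transition_pairs_def)
  note meas_K = borel_measurable_markov_kernel_integral[OF p g(1)]
  have meas: "D i \<in> borel_measurable N" if "X i \<in> N \<rightarrow>\<^sub>M borel" "Y i \<in> N \<rightarrow>\<^sub>M borel" for i N
    unfolding D_def
    using measurable_compose[OF that(1) f(1)] measurable_compose[OF that(2) g(1)]
      measurable_compose[OF that(1) meas_K] by measurable
  show "D i \<in> borel_measurable M" if "i \<ge> 1" for i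
    using meas X Y that by blast
  have A: "0 \<le> A"
    using order_trans[OF abs_ge_zero f(2)] by auto
  have bound: "\<bar>D i \<omega>\<bar> \<le> A * (B + B)" for i \<omega>
    unfolding D_def abs_mult using A f(2) g(2) markov_kernel_integral_bound(1)[OF p g]
    by (intro mult_mono order_trans[OF abs_triangle_ineq4] add_mono) auto
  then show "\<bar>D i \<omega>\<bar> \<le> A * (B + B)" for i \<omega> .
  fix i j :: nat assume ij: "1 \<le> i" "i < j"
  have "(\<lambda>\<omega>. D i \<omega> * f (X j \<omega>)) \<in> borel_measurable (past_algebra M X Y j)"
    using ij by (intro borel_measurable_times meas measurable_compose[OF _ f(1)] measurable_past_algebra) auto
  moreover have "\<bar>D i \<omega> * f (X j \<omega>)\<bar> \<le> (A * (B + B)) * A" for \<omega>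
    unfolding abs_mult using bound f(2) A by (intro mult_mono order_trans[OF abs_ge_zero bound]) auto
  ultimately have "(\<integral>\<omega>. (D i \<omega> * f (X j \<omega>)) * (g (Y j \<omega>) - (\<integral>y. g y \<partial>p (X j \<omega>))) \<partial>M) = 0"
    using ij by (intro transition_pairs_expectation[OF p XY _ _ _ g]) auto
  then show "(\<integral>\<omega>. D i \<omega> * D j \<omega> \<partial>M) = 0"
    by (simp add: D_def mult.assoc)
qed

section \<open>Continuous functions on the product\<close>

lemma compact_UNIV_continuous_bounded:
  fixes f :: "'a::topological_space \<Rightarrow> 'b::metric_space"
  assumes "compact (UNIV :: 'a set)" "continuous_on UNIV f"
  shows "bounded (range f)"
  using compact_continuous_image[OF assms(2,1)] by (rule compact_imp_bounded)

text \<open>Take tent functions of radius \<open>e\<close> around the points of a finite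
  \<open>e\<close>-net and divide by their sum, which is positive everywhere because the balls cover
  the space.\<close>

lemma partition_of_unity_mesh:
  fixes e :: real
  assumes "compact (UNIV :: 'a::metric_space set)" "e > 0"
  obtains Q :: "'a::metric_space set" and \<phi> :: "'a \<Rightarrow> 'a \<Rightarrow> real"
  where "finite Q" "\<And>q. continuous_on UNIV (\<phi> q)" "\<And>q x. 0 \<le> \<phi> q x"
    "\<And>x. (\<Sum>q\<in>Q. \<phi> q x) = 1" "\<And>q x. \<phi> q x \<noteq> 0 \<Longrightarrow> dist x q < e"
proof -
  obtain Q :: "'a set" where Q: "finite Q" "UNIV \<subseteq> (\<Union>q\<in>Q. ball q e)"
    using assms unfolding compact_eq_totally_bounded by blast
  define \<tau> where "\<tau> q x = max 0 (e - dist x q)" for q x :: 'a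
  have pos: "0 < (\<Sum>q\<in>Q. \<tau> q x)" for x
  proof -
    obtain q where "q \<in> Q" "dist q x < e" using Q(2) by force
    then show ?thesis
      using Q(1) by (intro sum_pos2[of Q q]) (auto simp: \<tau>_def dist_commute)
  qed
  show thesis
  proof (rule that[of Q "\<lambda>q x. \<tau> q x / (\<Sum>q\<in>Q. \<tau> q x)"])
    show "continuous_on UNIV (\<lambda>x. \<tau> q x / (\<Sum>q\<in>Q. \<tau> q x))" for q
      unfolding \<tau>_def
      by (intro continuous_intros ballI) (use pos in \<open>auto simp: \<tau>_def less_le\<close>)
    show "0 \<le> \<tau> q x / (\<Sum>q\<in>Q. \<tau> q x)" for q x
      using pos[of x] by (simp add: \<tau>_def)
    show "(\<Sum>q\<in>Q. \<tau> q x / (\<Sum>q\<in>Q. \<tau> q x)) = 1" for x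
      using pos[of x] by (simp add: sum_divide_distrib[symmetric])
    show "dist x q < e" if "\<tau> q x / (\<Sum>q\<in>Q. \<tau> q x) \<noteq> 0" for q x
      using that by (auto simp: \<tau>_def max_def split: if_splits)
  qed (rule Q(1))
qed

lemma partition_of_unity_sequence:
  assumes "compact (UNIV :: 'a::metric_space set)"
  obtains Q :: "nat \<Rightarrow> 'a::metric_space set" and \<phi> :: "nat \<Rightarrow> 'a \<Rightarrow> 'a \<Rightarrow> real"
  where "\<And>m. finite (Q m)" "\<And>m q. continuous_on UNIV (\<phi> m q)" "\<And>m q x. 0 \<le> \<phi> m q x"
    "\<And>m x. (\<Sum>q\<in>Q m. \<phi> m q x) = 1" "\<And>m q x. \<phi> m q x \<noteq> 0 \<Longrightarrow> dist x q < 1 / real (Suc m)"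
proof -
  have "\<exists>Q\<phi>. finite (fst Q\<phi>) \<and> (\<forall>q. continuous_on UNIV (snd Q\<phi> q)) \<and>
      (\<forall>q x. 0 \<le> snd Q\<phi> q x) \<and> (\<forall>x. (\<Sum>q\<in>fst Q\<phi>. snd Q\<phi> q x) = (1::real)) \<and>
      (\<forall>q x. snd Q\<phi> q x \<noteq> 0 \<longrightarrow> dist x (q :: 'a) < 1 / real (Suc m))" (is "\<exists>Q\<phi>. ?G m Q\<phi>") for m
  proof -
    obtain Q :: "'a set" and \<phi> :: "'a \<Rightarrow> 'a \<Rightarrow> real" where "finite Q" "\<And>q. continuous_on UNIV (\<phi> q)" "\<And>q x. 0 \<le> \<phi> q x"
      "\<And>x. (\<Sum>q\<in>Q. \<phi> q x) = 1" "\<And>q x. \<phi> q x \<noteq> 0 \<Longrightarrow> dist x q < 1 / real (Suc m)"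
      using partition_of_unity_mesh[OF assms, of "1 / real (Suc m)"] zero_less_divide_1_iff of_nat_0_less_iff zero_less_Suc
      by blast
    then have "?G m (Q, \<phi>)" by simp
    then show ?thesis by blast
  qed
  then obtain Q\<phi> where "\<And>m. ?G m (Q\<phi> m)"
    using choice[of ?G] by blast
  then show thesis
    by (intro that[of "\<lambda>m. fst (Q\<phi> m)" "\<lambda>m. snd (Q\<phi> m)"]) blast+
qed

text \<open>A partition of unity at each scale \<open>1 / Suc m\<close> gives countably many products \<open>f(x) g(y)\<close>
  whose span is uniformly dense.\<close>

lemma tensor_approximation:
  assumes "compact (UNIV :: 'a::metric_space set)" "compact (UNIV :: 'b::metric_space set)"
  obtains Q :: "nat \<Rightarrow> 'a::metric_space set" and R :: "nat \<Rightarrow> 'b::metric_space set"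
    and \<phi> :: "nat \<Rightarrow> 'a \<Rightarrow> 'a \<Rightarrow> real" and \<psi> :: "nat \<Rightarrow> 'b \<Rightarrow> 'b \<Rightarrow> real"
  where "\<And>m. finite (Q m)" "\<And>m. finite (R m)"
    "\<And>m q. continuous_on UNIV (\<phi> m q)" "\<And>m r. continuous_on UNIV (\<psi> m r)"
    "\<And>h e. continuous_on UNIV h \<Longrightarrow> e > 0 \<Longrightarrow>
      \<exists>m. \<forall>x y. \<bar>h (x, y) - (\<Sum>q\<in>Q m. \<Sum>r\<in>R m. h (q, r) * (\<phi> m q x * \<psi> m r y))\<bar> \<le> e"
proof -
  obtain Q :: "nat \<Rightarrow> 'a set" and \<phi> :: "nat \<Rightarrow> 'a \<Rightarrow> 'a \<Rightarrow> real" where Q: "\<And>m. finite (Q m)" "\<And>m q. continuous_on UNIV (\<phi> m q)"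
    "\<And>m q x. 0 \<le> \<phi> m q x" "\<And>m x. (\<Sum>q\<in>Q m. \<phi> m q x) = 1"
    "\<And>m q x. \<phi> m q x \<noteq> 0 \<Longrightarrow> dist x q < 1 / real (Suc m)"
    using partition_of_unity_sequence[OF assms(1)] by blast
  obtain R :: "nat \<Rightarrow> 'b set" and \<psi> :: "nat \<Rightarrow> 'b \<Rightarrow> 'b \<Rightarrow> real" where R: "\<And>m. finite (R m)" "\<And>m r. continuous_on UNIV (\<psi> m r)"
    "\<And>m r y. 0 \<le> \<psi> m r y" "\<And>m y. (\<Sum>r\<in>R m. \<psi> m r y) = 1"
    "\<And>m r y. \<psi> m r y \<noteq> 0 \<Longrightarrow> dist y r < 1 / real (Suc m)"
    using partition_of_unity_sequence[OF assms(2)] by blast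
  show thesis
  proof (rule that[of Q R \<phi> \<psi>])
    fix h :: "'a \<times> 'b \<Rightarrow> real" and e :: real
    assume h: "continuous_on UNIV h" and e: "e > 0"
    have "compact (UNIV :: ('a \<times> 'b) set)"
      using compact_Times[OF assms] by simp
    then have "uniformly_continuous_on UNIV h"
      using h by (rule compact_uniformly_continuous[rotated])
    then obtain \<delta> where \<delta>: "\<delta> > 0" "\<And>z z'. dist z z' < \<delta> \<Longrightarrow> \<bar>h z - h z'\<bar> < e"
      using e unfolding uniformly_continuous_on_def by (metis UNIV_I dist_commute dist_real_def)
    \<comment> \<open>Half of \<delta> for each coordinate, since the distance in the product is at
      most the sum of the coordinate distances.\<close>
    obtain m where m: "1 / real (Suc m) < \<delta> / 2"
      using \<delta>(1) nat_approx_posE[of "\<delta> / 2"] by auto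
    have "\<bar>h (x, y) - (\<Sum>q\<in>Q m. \<Sum>r\<in>R m. h (q, r) * (\<phi> m q x * \<psi> m r y))\<bar> \<le> e" for x y
    proof -
      \<comment> \<open>The weights add up to 1, so the error is a weighted average of the
        differences \<open>h (x, y) - h (q, r)\<close>, and every pair (q, r) far from (x, y) has
        weight 0.\<close>
      have unit: "(\<Sum>q\<in>Q m. \<Sum>r\<in>R m. c * (\<phi> m q x * \<psi> m r y)) = c" for c
        by (simp add: sum_distrib_left[symmetric] Q(4) R(4))
      have close: "\<bar>(h (x, y) - h (q, r)) * (\<phi> m q x * \<psi> m r y)\<bar> \<le> e * (\<phi> m q x * \<psi> m r y)" for q r
      proof (cases "\<phi> m q x = 0 \<or> \<psi> m r y = 0")
        case False
        then have "dist x q < \<delta> / 2" "dist y r < \<delta> / 2"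
          using Q(5)[of m q x] R(5)[of m r y] m by auto
        then have "dist (x, y) (q, r) < \<delta>"
          using sqrt_sum_squares_le_sum[of "dist x q" "dist y r"] by (simp add: dist_Pair_Pair)
        then have "\<bar>h (x, y) - h (q, r)\<bar> \<le> e"
          using \<delta>(2)[of "(x, y)" "(q, r)"] by simp
        then show ?thesis
          unfolding abs_mult using Q(3)[of m q x] R(3)[of m r y] by (intro mult_mono) auto
      qed auto
      have "h (x, y) - (\<Sum>q\<in>Q m. \<Sum>r\<in>R m. h (q, r) * (\<phi> m q x * \<psi> m r y))
          = (\<Sum>q\<in>Q m. \<Sum>r\<in>R m. (h (x, y) - h (q, r)) * (\<phi> m q x * \<psi> m r y))"
        unfolding left_diff_distrib sum_subtractf unit ..
      also have "\<bar>\<dots>\<bar> \<le> (\<Sum>q\<in>Q m. \<Sum>r\<in>R m. e * (\<phi> m q x * \<psi> m r y))"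
        by (intro order_trans[OF sum_abs] sum_mono close)
      finally show ?thesis unfolding unit .
    qed
    then show "\<exists>m. \<forall>x y. \<bar>h (x, y) - (\<Sum>q\<in>Q m. \<Sum>r\<in>R m. h (q, r) * (\<phi> m q x * \<psi> m r y))\<bar> \<le> e"
      by blast
  qed (fact Q R)+
qed

section \<open>Joint law of a measure and a kernel\<close>

text \<open>Draw x from \<mu>, then y from \<open>p x\<close>. The fibres are placed directly on the
  Borel sets of the product space, so the result lives where the weak topology on the product is
  defined.\<close>

definition kernel_joint ::
    "('a::second_countable_topology \<Rightarrow> 'b::second_countable_topology measure) \<Rightarrow> 'a measure \<Rightarrow> ('a \<times> 'b) measure"
  where "kernel_joint p \<mu> = \<mu> \<bind> (\<lambda>x. distr (p x) borel (Pair x))"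

text \<open>Second countability enters here: it makes Borel sets of the product space measurable for
  the product sigma-algebra, hence pairing jointly measurable.\<close>

lemma measurable_kernel_joint_fibre:
  fixes p :: "'a::second_countable_topology \<Rightarrow> 'b::second_countable_topology measure"
  assumes p: "markov_kernel p"
  shows "(\<lambda>x. distr (p x) borel (Pair x)) \<in> borel \<rightarrow>\<^sub>M prob_algebra borel"
proof (rule measurable_prob_algebraI)
  have sets: "sets (p x) = sets borel" "prob_space (p x)" for x
    using p by (auto simp: markov_kernel_def)
  have "Pair x \<in> borel \<rightarrow>\<^sub>M (borel :: ('a \<times> 'b) measure)" for x
    by measurable
  then show "prob_space (distr (p x) borel (Pair x))" for x
    using sets measurable_cong_sets[OF sets(1) refl] by (intro prob_space.prob_space_distr) blast+
  have "(\<lambda>z. (fst z, snd z)) \<in> borel \<Otimes>\<^sub>M borel \<rightarrow>\<^sub>M (borel :: ('a \<times> 'b) measure)"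
    by measurable
  then show "(\<lambda>x. distr (p x) borel (Pair x)) \<in> borel \<rightarrow>\<^sub>M subprob_algebra borel"
    by (intro measurable_distr2[OF _ measurable_prob_algebraD[OF measurable_markov_kernel[OF p]]])
      (simp add: case_prod_beta')
qed

lemma kernel_joint_in_prob_algebra:
  assumes "markov_kernel p" "\<mu> \<in> space (prob_algebra borel)"
  shows "kernel_joint p \<mu> \<in> space (prob_algebra borel)"
  unfolding kernel_joint_def
  using measurable_space[OF measurable_bind_prob_space[OF measurable_ident measurable_kernel_joint_fibre[OF assms(1)]] assms(2)]
  by (simp add: id_def)

lemma integral_kernel_joint:
  fixes h :: "'a::second_countable_topology \<times> 'b::second_countable_topology \<Rightarrow> real"
  assumes p: "markov_kernel p" and \<mu>: "\<mu> \<in> space (prob_algebra borel)"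
    and h: "h \<in> borel_measurable borel" "\<And>z. \<bar>h z\<bar> \<le> B"
  shows "(\<integral>z. h z \<partial>kernel_joint p \<mu>) = (\<integral>x. (\<integral>y. h (x, y) \<partial>p x) \<partial>\<mu>)"
proof -
  have sets: "sets (p x) = sets borel" "prob_space (p x)" for x
    using p by (auto simp: markov_kernel_def)
  have \<mu>': "sets \<mu> = sets borel" "prob_space \<mu>"
    using \<mu> by (auto simp: space_prob_algebra)
  have "Pair x \<in> borel \<rightarrow>\<^sub>M (borel :: ('a \<times> 'b) measure)" for x
    by measurable
  then have Pair: "Pair x \<in> p x \<rightarrow>\<^sub>M (borel :: ('a \<times> 'b) measure)" for x
    using measurable_cong_sets[OF sets(1) refl] by blast
  have fibre: "(\<lambda>x. distr (p x) borel (Pair x)) \<in> \<mu> \<rightarrow>\<^sub>M subprob_algebra borel"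
    using measurable_prob_algebraD[OF measurable_kernel_joint_fibre[OF p]]
      measurable_cong_sets[OF \<mu>'(1) refl] by blast
  have "(\<integral>z. h z \<partial>kernel_joint p \<mu>) = (\<integral>x. (\<integral>z. h z \<partial>distr (p x) borel (Pair x)) \<partial>\<mu>)"
    unfolding kernel_joint_def
  proof (rule integral_bind[OF h(1) _ fibre, where B'=1])
    show "finite_measure \<mu>"
      using \<mu>'(2) by (rule prob_space.finite_measure)
    show "AE x in \<mu>. emeasure (distr (p x) borel (Pair x)) (space (distr (p x) borel (Pair x))) \<le> ennreal 1"
      using prob_space.emeasure_space_1[OF prob_space.prob_space_distr[OF sets(2) Pair]]
      by (intro AE_I2) simp
  qed (rule h(2))
  also have "(\<lambda>x. \<integral>z. h z \<partial>distr (p x) borel (Pair x)) = (\<lambda>x. \<integral>y. h (x, y) \<partial>p x)"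
    using integral_distr[OF Pair h(1)] by simp
  finally show ?thesis .
qed

text \<open>The integral formula applied to an indicator. It holds for all \<open>A\<close> and
  \<open>B\<close> without exceptional sets, so a single null set serves all rectangles in the
  theorem.\<close>

lemma measure_kernel_joint_Times:
  assumes p: "markov_kernel p" and \<mu>: "\<mu> \<in> space (prob_algebra borel)"
    and A: "A \<in> sets borel" and B: "B \<in> sets borel"
  shows "measure (kernel_joint p \<mu>) (A \<times> B) = (LINT x:A|\<mu>. measure (p x) B)"
proof -
  have AB: "A \<times> B \<in> sets borel"
    using A B by (rule borel_Times)
  have sets: "space (p x) = UNIV" for x
    using p sets_eq_imp_space_eq[of "p x" borel] by (auto simp: markov_kernel_def)
  have joint: "space (kernel_joint p \<mu>) = UNIV"
    using kernel_joint_in_prob_algebra[OF p \<mu>] sets_eq_imp_space_eq[of "kernel_joint p \<mu>" borel]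
    by (auto simp: space_prob_algebra)
  have "measure (kernel_joint p \<mu>) (A \<times> B) = (\<integral>z. indicator (A \<times> B) z \<partial>kernel_joint p \<mu>)"
    by (simp add: joint)
  also have "\<dots> = (\<integral>x. (\<integral>y. indicator (A \<times> B) (x, y) \<partial>p x) \<partial>\<mu>)"
    using AB by (intro integral_kernel_joint[OF p \<mu>, where B=1]) (auto simp: indicator_def)
  also have "\<dots> = (LINT x:A|\<mu>. measure (p x) B)"
    unfolding set_lebesgue_integral_def
    by (intro Bochner_Integration.integral_cong refl) (simp add: indicator_times sets)
  finally show ?thesis .
qed

text \<open>The point x occurs in the integrand and in the measure. Uniform continuity of
  \<open>h\<close> makes the change of the integrand small against every probability measure
  \<open>p x'\<close>; once the slice at x is frozen, the Feller property handles the change of the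
  measure.\<close>

lemma continuous_on_kernel_integral:
  fixes p :: "'a::metric_space \<Rightarrow> 'b::metric_space measure" and h :: "'a \<times> 'b \<Rightarrow> real"
  assumes "compact (UNIV :: 'a set)" "compact (UNIV :: 'b set)"
    and p: "markov_kernel p" "feller_continuous p" and h: "continuous_on UNIV h"
  shows "continuous_on UNIV (\<lambda>x. \<integral>y. h (x, y) \<partial>p x)"
proof -
  have UNIV: "compact (UNIV :: ('a \<times> 'b) set)"
    using compact_Times[OF assms(1,2)] by simp
  obtain B where B: "\<And>z. \<bar>h z\<bar> \<le> B"
    using compact_UNIV_continuous_bounded[OF UNIV h] by (auto simp: bounded_iff)
  have slice: "continuous_on UNIV (\<lambda>y. h (x, y))" for x
    by (intro continuous_on_compose2[OF h] continuous_intros) auto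
  note meas = borel_measurable_continuous_onI[OF slice]
  note int = markov_kernel_integral_bound(2)[OF p(1) meas B]
  have "((\<lambda>x'. \<integral>y. h (x', y) \<partial>p x') \<longlongrightarrow> (\<integral>y. h (x, y) \<partial>p x)) (at x)" for x
  proof -
    have "((\<lambda>x'. \<integral>y. h (x', y) - h (x, y) \<partial>p x') \<longlongrightarrow> 0) (at x)"
    proof (rule tendstoI)
      fix e :: real assume "e > 0"
      then obtain \<delta> where \<delta>: "\<delta> > 0" "\<And>z z'. dist z z' < \<delta> \<Longrightarrow> \<bar>h z - h z'\<bar> < e / 2"
        using compact_uniformly_continuous[OF h UNIV] half_gt_zero unfolding uniformly_continuous_on_def
        by (metis UNIV_I dist_commute dist_real_def)
      have "dist (\<integral>y. h (x', y) - h (x, y) \<partial>p x') 0 < e" if "dist x' x < \<delta>" for x'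
      proof -
        have "\<bar>\<integral>y. h (x', y) - h (x, y) \<partial>p x'\<bar> \<le> e / 2"
          using \<delta>(2)[of "(x', _)" "(x, _)"] that
          by (intro markov_kernel_integral_bound(1)[OF p(1)] borel_measurable_diff meas)
            (simp add: dist_Pair_Pair less_imp_le)
        with \<open>e > 0\<close> show ?thesis by simp
      qed
      then show "\<forall>\<^sub>F x' in at x. dist (\<integral>y. h (x', y) - h (x, y) \<partial>p x') 0 < e"
        using \<delta>(1) by (auto simp: eventually_at)
    qed
    moreover have "continuous_on UNIV (\<lambda>x'. \<integral>y. h (x, y) \<partial>p x')"
      using p(2) slice compact_UNIV_continuous_bounded[OF assms(2) slice]
      by (auto simp: feller_continuous_def)
    then have "((\<lambda>x'. \<integral>y. h (x, y) \<partial>p x') \<longlongrightarrow> (\<integral>y. h (x, y) \<partial>p x)) (at x)"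
      by (simp add: continuous_on_def)
    ultimately have "((\<lambda>x'. (\<integral>y. h (x', y) - h (x, y) \<partial>p x') + (\<integral>y. h (x, y) \<partial>p x'))
        \<longlongrightarrow> 0 + (\<integral>y. h (x, y) \<partial>p x)) (at x)"
      by (rule tendsto_add)
    then show ?thesis
      by (simp add: Bochner_Integration.integral_diff int)
  qed
  then show ?thesis by (simp add: continuous_on_def)
qed

text \<open>The test function \<open>h\<close> pulls back to the function of the preceding lemma,
  which is bounded by compactness.\<close>

lemma continuous_map_kernel_joint:
  fixes p :: "'a::{metric_space, second_countable_topology} \<Rightarrow> 'b::{metric_space, second_countable_topology} measure"
  assumes cpt: "compact (UNIV :: 'a set)" "compact (UNIV :: 'b set)"
    and p: "markov_kernel p" "feller_continuous p"
  shows "continuous_map weak_topology weak_topology (kernel_joint p)"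
proof (rule continuous_map_weak_topologyI)
  show "kernel_joint p \<mu> \<in> space (prob_algebra borel)" if "\<mu> \<in> space (prob_algebra borel)" for \<mu>
    using p(1) that by (rule kernel_joint_in_prob_algebra)
  fix h :: "'a \<times> 'b \<Rightarrow> real"
  assume h: "continuous_on UNIV h" "bounded (range h)"
  then obtain B where B: "\<And>z. \<bar>h z\<bar> \<le> B" by (auto simp: bounded_iff)
  let ?f = "\<lambda>x. \<integral>y. h (x, y) \<partial>p x"
  have "continuous_on UNIV ?f"
    using cpt p h(1) by (rule continuous_on_kernel_integral)
  moreover have "(\<integral>z. h z \<partial>kernel_joint p \<mu>) = (\<integral>x. ?f x \<partial>\<mu>)" if "\<mu> \<in> space (prob_algebra borel)" for \<mu>
    using p(1) that borel_measurable_continuous_onI[OF h(1)] B by (rule integral_kernel_joint)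
  ultimately show "\<exists>f. continuous_on UNIV f \<and> bounded (range f) \<and>
      (\<forall>\<mu>\<in>space (prob_algebra borel). (\<integral>z. h z \<partial>kernel_joint p \<mu>) = (\<integral>x. f x \<partial>\<mu>))"
    using compact_UNIV_continuous_bounded[OF cpt(1)] by blast
qed

section \<open>First marginals\<close>

lemma integral_marginal:
  fixes f :: "'a::second_countable_topology \<Rightarrow> real"
    and \<mu> :: "('a \<times> 'b::second_countable_topology) measure"
  assumes "sets \<mu> = sets borel" "f \<in> borel_measurable borel"
  shows "(\<integral>x. f x \<partial>distr \<mu> borel fst) = (\<integral>z. f (fst z) \<partial>\<mu>)"
proof (rule integral_distr)
  have "fst \<in> borel \<rightarrow>\<^sub>M (borel :: 'a measure)"
    by (intro borel_measurable_continuous_onI continuous_intros)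
  then show "fst \<in> \<mu> \<rightarrow>\<^sub>M borel"
    using measurable_cong_sets[OF assms(1) refl] by blast
qed (rule assms(2))

lemma continuous_map_marginal:
  "continuous_map weak_topology weak_topology
    (\<lambda>\<mu> :: ('a::second_countable_topology \<times> 'b::second_countable_topology) measure. distr \<mu> borel fst)"
proof (rule continuous_map_weak_topologyI)
  have "fst \<in> borel \<rightarrow>\<^sub>M (borel :: 'a measure)"
    by (intro borel_measurable_continuous_onI continuous_intros)
  then show "distr \<mu> borel fst \<in> space (prob_algebra (borel :: 'a measure))"
    if "\<mu> \<in> space (prob_algebra borel)" for \<mu> :: "('a \<times> 'b) measure"
    using that measurable_cong_sets[of \<mu> borel borel "borel :: 'a measure"]
    by (auto simp: space_prob_algebra intro!: prob_space.prob_space_distr)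
  fix h :: "'a \<Rightarrow> real"
  assume h: "continuous_on UNIV h" "bounded (range h)"
  have "continuous_on UNIV (\<lambda>z :: 'a \<times> 'b. h (fst z))"
    by (intro continuous_on_compose2[OF h(1)] continuous_intros) auto
  moreover have "bounded (range (\<lambda>z :: 'a \<times> 'b. h (fst z)))"
    using h(2) by (rule bounded_subset) auto
  ultimately show "\<exists>f :: 'a \<times> 'b \<Rightarrow> real. continuous_on UNIV f \<and> bounded (range f) \<and>
      (\<forall>\<mu>\<in>space (prob_algebra borel). (\<integral>y. h y \<partial>distr \<mu> borel fst) = (\<integral>x. f x \<partial>\<mu>))"
    using integral_marginal[OF _ borel_measurable_continuous_onI[OF h(1)]]
    by (auto simp: space_prob_algebra)
qed

lemma empirical_measure_marginal:
  fixes z :: "nat \<Rightarrow> 'a::second_countable_topology \<times> 'b::second_countable_topology"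
  assumes "n \<ge> 1"
  shows "distr (empirical_measure z n) borel fst = empirical_measure (\<lambda>i. fst (z i)) n"
proof -
  have "fst \<in> borel \<rightarrow>\<^sub>M (borel :: 'a measure)"
    by (intro borel_measurable_continuous_onI continuous_intros)
  then have "distr (distr (measure_pmf (pmf_of_set {1..n})) borel z) borel fst
      = distr (measure_pmf (pmf_of_set {1..n})) borel (fst \<circ> z)"
    by (rule distr_distr) simp
  with assms show ?thesis
    by (simp add: empirical_measure_eq_distr comp_def)
qed

section \<open>Convergence in probability along subsequences\<close>

text \<open>Truncation at 1 turns convergence in probability into convergence in L1, which has
  almost surely convergent subsequences. Where the truncated values tend to 0 they are eventually
  below 1 and equal the original ones.\<close>

lemma (in prob_space) convergence_in_prob_imp_AE_subseq:
  fixes u :: "nat \<Rightarrow> 'a \<Rightarrow> real"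
  assumes meas: "\<And>n. n \<ge> 1 \<Longrightarrow> u n \<in> borel_measurable M" and nonneg: "\<And>n \<omega>. 0 \<le> u n \<omega>"
    and conv: "\<And>\<epsilon>. \<epsilon> > 0 \<Longrightarrow> (\<lambda>n. prob {\<omega> \<in> space M. u n \<omega> > \<epsilon>}) \<longlonglongrightarrow> 0"
    and s: "strict_mono (s :: nat \<Rightarrow> nat)"
  shows "\<exists>r. strict_mono r \<and> (AE \<omega> in M. (\<lambda>k. u (s (r k)) \<omega>) \<longlonglongrightarrow> 0)"
proof -
  \<comment> \<open>\<open>s 0\<close> may be 0, and \<open>u 0\<close> is not assumed measurable;
    the shift makes all indices positive.\<close>
  define s' where "s' k = s (Suc k)" for k
  have s': "strict_mono s'" "\<And>k. s' k \<ge> 1"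
    using s strict_mono_less[OF s] by (auto simp: s'_def strict_mono_Suc_iff Suc_le_eq intro: le_less_trans[OF le0])
  define w where "w k \<omega> = min 1 (u (s' k) \<omega>)" for k \<omega>
  have meas_u [measurable]: "u (s' k) \<in> borel_measurable M" for k
    using meas s'(2) by blast
  have int_w: "integrable M (w k)" for k
    unfolding w_def by (intro integrable_const_bound[where B=1]) (use nonneg in auto)
  have "(\<lambda>k. \<integral>\<omega>. norm (w k \<omega>) \<partial>M) \<longlonglongrightarrow> 0"
  proof (rule tendstoI)
    fix e :: real assume e: "e > 0"
    have "(\<lambda>k. prob {\<omega> \<in> space M. u (s' k) \<omega> > e / 2}) \<longlonglongrightarrow> 0"
      using LIMSEQ_subseq_LIMSEQ[OF conv[of "e / 2"] s'(1)] e by (simp add: comp_def)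
    then have "\<forall>\<^sub>F k in sequentially. prob {\<omega> \<in> space M. u (s' k) \<omega> > e / 2} < e / 2"
      using e by (intro order_tendstoD(2)) auto
    then show "\<forall>\<^sub>F k in sequentially. dist (\<integral>\<omega>. norm (w k \<omega>) \<partial>M) 0 < e"
    proof eventually_elim
      case (elim k)
      let ?E = "{\<omega> \<in> space M. u (s' k) \<omega> > e / 2}"
      have E: "?E \<in> sets M" by measurable
      \<comment> \<open>On \<open>?E\<close> the truncated variable is at most 1, off
        \<open>?E\<close> at most e/2.\<close>
      have "(\<integral>\<omega>. norm (w k \<omega>) \<partial>M) \<le> (\<integral>\<omega>. e / 2 + indicator ?E \<omega> \<partial>M)"
      proof (rule integral_mono)
        show "integrable M (\<lambda>\<omega>. e / 2 + indicator ?E \<omega> :: real)"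
          using E by (intro Bochner_Integration.integrable_add integrable_const integrable_real_indicator)
            (auto simp: emeasure_eq_measure)
        show "norm (w k \<omega>) \<le> e / 2 + indicator ?E \<omega>" if "\<omega> \<in> space M" for \<omega>
          using e nonneg[of "s' k" \<omega>] that by (auto simp: w_def indicator_def)
      qed (use int_w in simp)
      also have "\<dots> = e / 2 + prob ?E"
        using E by (simp add: prob_space emeasure_eq_measure)
      finally show ?case using elim by simp
    qed
  qed
  from tendsto_L1_AE_subseq[OF int_w this]
  obtain r where r: "strict_mono r" "AE \<omega> in M. (\<lambda>k. w (r k) \<omega>) \<longlonglongrightarrow> 0" by blast
  have "AE \<omega> in M. (\<lambda>k. u (s' (r k)) \<omega>) \<longlonglongrightarrow> 0"
    using r(2)
  proof eventually_elim
    case (elim \<omega>)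
    then have "\<forall>\<^sub>F k in sequentially. w (r k) \<omega> < 1"
      by (intro order_tendstoD(2)) auto
    then have "\<forall>\<^sub>F k in sequentially. w (r k) \<omega> = u (s' (r k)) \<omega>"
      by eventually_elim (auto simp: w_def min_def split: if_splits)
    with elim show ?case by (rule Lim_transform_eventually)
  qed
  moreover have "strict_mono (\<lambda>k. Suc (r k))"
    using r(1) by (simp add: strict_mono_def)
  ultimately show ?thesis
    unfolding s'_def by blast
qed

text \<open>Otherwise the probabilities stay above some e > 0 along a subsequence. Along a further,
  almost surely convergent one the indicators of the events tend to 0, and dominated convergence
  contradicts the lower bound.\<close>

lemma (in prob_space) AE_subseq_imp_convergence_in_prob:
  fixes u :: "nat \<Rightarrow> 'a \<Rightarrow> real"
  assumes meas: "\<And>n. n \<ge> 1 \<Longrightarrow> u n \<in> borel_measurable M"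
    and subseq: "\<And>s :: nat \<Rightarrow> nat. strict_mono s \<Longrightarrow>
      \<exists>r. strict_mono r \<and> (AE \<omega> in M. (\<lambda>k. u (s (r k)) \<omega>) \<longlonglongrightarrow> 0)"
    and "\<epsilon> > 0"
  shows "(\<lambda>n. prob {\<omega> \<in> space M. u n \<omega> > \<epsilon>}) \<longlonglongrightarrow> 0"
proof (rule ccontr)
  define a where "a n = prob {\<omega> \<in> space M. u n \<omega> > \<epsilon>}" for n
  assume "\<not> a \<longlonglongrightarrow> 0"
  then obtain e where e: "e > 0" "\<And>N. \<exists>n\<ge>N. a n \<ge> e"
    by (auto simp: LIMSEQ_iff a_def not_less)
  have "infinite {n. n \<ge> 1 \<and> a n \<ge> e}"
    unfolding infinite_nat_iff_unbounded_le
  proof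
    fix N show "\<exists>n\<ge>N. n \<in> {n. n \<ge> 1 \<and> a n \<ge> e}"
      using e(2)[of "max N 1"] by auto
  qed
  then obtain s :: "nat \<Rightarrow> nat" where s: "strict_mono s" "\<And>k. s k \<ge> 1" "\<And>k. a (s k) \<ge> e"
    using infinite_enumerate by blast
  obtain r where r: "AE \<omega> in M. (\<lambda>k. u (s (r k)) \<omega>) \<longlonglongrightarrow> 0"
    using subseq[OF s(1)] by blast
  define E where "E k = {\<omega> \<in> space M. u (s (r k)) \<omega> > \<epsilon>}" for k
  have [measurable]: "u (s (r k)) \<in> borel_measurable M" for k
    using meas s(2) by blast
  have E: "E k \<in> sets M" for k
    unfolding E_def by measurable
  have "(\<lambda>k. \<integral>\<omega>. indicator (E k) \<omega> \<partial>M) \<longlonglongrightarrow> (\<integral>\<omega>. 0 \<partial>M :: real)"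
  proof (rule integral_dominated_convergence[where w="\<lambda>_. 1"])
    show "AE \<omega> in M. (\<lambda>k. indicator (E k) \<omega> :: real) \<longlonglongrightarrow> 0"
      using r
    proof eventually_elim
      case (elim \<omega>)
      then have "\<forall>\<^sub>F k in sequentially. u (s (r k)) \<omega> < \<epsilon>"
        using \<open>\<epsilon> > 0\<close> by (rule order_tendstoD(2))
      then have "\<forall>\<^sub>F k in sequentially. indicator (E k) \<omega> = (0 :: real)"
        by eventually_elim (simp add: E_def)
      then show ?case by (rule tendsto_eventually)
    qed
  qed (use E in \<open>auto simp: indicator_def\<close>)
  then have "(\<lambda>k. a (s (r k))) \<longlonglongrightarrow> 0"
    using E by (simp add: E_def a_def Int_absorb2 sets.sets_into_space)
  then show False
    using e(1) s(3) by (meson LIMSEQ_le_const not_le)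
qed

text \<open>Both directions use that the distances are random variables, by
  \<open>borel_measurable_dist_empirical_measure\<close>: otherwise the value 0 of
  \<open>measure\<close> on nonmeasurable sets could feign convergence.\<close>

lemma limit_measure_prob_iff_subseq:
  fixes X :: "nat \<Rightarrow> 'w \<Rightarrow> 'a::{metric_space, second_countable_topology}"
  assumes "prob_space M" "metrizes_weak_convergence d" "\<forall>i\<ge>1. X i \<in> M \<rightarrow>\<^sub>M borel"
  shows "limit_measure_prob M d X P \<longleftrightarrow> random_measure M P \<and>
    (\<forall>s :: nat \<Rightarrow> nat. strict_mono s \<longrightarrow> (\<exists>r. strict_mono r \<and>
      (AE \<omega> in M. (\<lambda>k. d (empirical_measure (\<lambda>i. X i \<omega>) (s (r k))) (P \<omega>)) \<longlonglongrightarrow> 0)))"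
    (is "_ \<longleftrightarrow> _ \<and> ?S")
proof -
  interpret prob_space M by fact
  interpret Metric_space "space (prob_algebra (borel :: 'a measure))" d
    using assms(2) by (simp add: metrizes_weak_convergence_def)
  let ?u = "\<lambda>n \<omega>. d (empirical_measure (\<lambda>i. X i \<omega>) n) (P \<omega>)"
  have "(\<forall>\<epsilon>>0. (\<lambda>n. prob {\<omega> \<in> space M. ?u n \<omega> > \<epsilon>}) \<longlonglongrightarrow> 0) \<longleftrightarrow> ?S" if P: "random_measure M P"
  proof -
    have meas: "?u n \<in> borel_measurable M" if "n \<ge> 1" for n
      using assms(2) that assms(3)[rule_format] P by (rule borel_measurable_dist_empirical_measure)
    show ?thesis
    proof (intro iffI allI impI)
      fix s :: "nat \<Rightarrow> nat"
      assume "\<forall>\<epsilon>>0. (\<lambda>n. prob {\<omega> \<in> space M. ?u n \<omega> > \<epsilon>}) \<longlonglongrightarrow> 0" "strict_mono s"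
      then show "\<exists>r. strict_mono r \<and> (AE \<omega> in M. (\<lambda>k. ?u (s (r k)) \<omega>) \<longlonglongrightarrow> 0)"
        using meas by (intro convergence_in_prob_imp_AE_subseq[of ?u]) auto
    next
      fix \<epsilon> :: real
      assume "?S" "\<epsilon> > 0"
      then show "(\<lambda>n. prob {\<omega> \<in> space M. ?u n \<omega> > \<epsilon>}) \<longlonglongrightarrow> 0"
        using meas by (intro AE_subseq_imp_convergence_in_prob[of ?u]) auto
    qed
  qed
  then show ?thesis
    unfolding limit_measure_prob_def by blast
qed

section \<open>Limits of empirical measures of transition pairs\<close>

lemma metrizes_weak_convergence_unique:
  assumes "metrizes_weak_convergence d" "\<mu> \<in> space (prob_algebra borel)" "\<nu> \<in> space (prob_algebra borel)"
    "\<forall>\<^sub>F n in F. m n \<in> space (prob_algebra borel)" "F \<noteq> bot"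
    "((\<lambda>n. d (m n) \<mu>) \<longlongrightarrow> 0) F" "((\<lambda>n. d (m n) \<nu>) \<longlongrightarrow> 0) F"
  shows "\<mu> = \<nu>"
proof -
  interpret Metric_space "space (prob_algebra borel)" d
    using assms(1) by (simp add: metrizes_weak_convergence_def)
  show ?thesis
    using assms limitin_metric_unique[of m \<mu> F \<nu>] by (simp add: limitin_metric_dist_null)
qed

text \<open>At index 0 the empirical measure is the zero measure, so membership can only be expected
  eventually.\<close>

lemma eventually_empirical_measure_in_prob_algebra:
  assumes "filterlim r at_top F"
  shows "\<forall>\<^sub>F k in F. empirical_measure x (r k) \<in> space (prob_algebra borel)"
  using filterlim_at_top[THEN iffD1, OF assms, rule_format, of 1]
  by eventually_elim (rule empirical_measure_in_prob_algebra)

text \<open>The law of large numbers for the countably many products of \<open>tensor_approximation\<close> yields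
  a single null set outside of which it holds for all continuous \<open>h\<close>.\<close>

lemma transition_pairs_continuous_average_tendsto_0:
  fixes p :: "'a::{metric_space, second_countable_topology} \<Rightarrow> 'b::{metric_space, second_countable_topology} measure"
  assumes cpt: "compact (UNIV :: 'a set)" "compact (UNIV :: 'b set)" and M: "prob_space M"
    and p: "markov_kernel p" and XY: "transition_pairs M p X Y"
  shows "AE \<omega> in M. \<forall>h. continuous_on UNIV h \<longrightarrow>
    (\<lambda>n. (\<Sum>i=1..n. h (X i \<omega>, Y i \<omega>) - (\<integral>y. h (X i \<omega>, y) \<partial>p (X i \<omega>))) / real n) \<longlonglongrightarrow> 0"
proof -
  interpret prob_space M by fact
  obtain Q :: "nat \<Rightarrow> 'a set" and R :: "nat \<Rightarrow> 'b set"
    and \<phi> :: "nat \<Rightarrow> 'a \<Rightarrow> 'a \<Rightarrow> real" and \<psi> :: "nat \<Rightarrow> 'b \<Rightarrow> 'b \<Rightarrow> real"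
    where fin: "\<And>m. finite (Q m)" "\<And>m. finite (R m)"
    and cont: "\<And>m q. continuous_on UNIV (\<phi> m q)" "\<And>m r. continuous_on UNIV (\<psi> m r)"
    and approx: "\<And>h e. continuous_on UNIV h \<Longrightarrow> e > 0 \<Longrightarrow>
      \<exists>m. \<forall>x y. \<bar>h (x, y) - (\<Sum>q\<in>Q m. \<Sum>r\<in>R m. h (q, r) * (\<phi> m q x * \<psi> m r y))\<bar> \<le> e"
    using tensor_approximation[OF cpt] by blast
  define D where "D h \<omega> i = h (X i \<omega>, Y i \<omega>) - (\<integral>y. h (X i \<omega>, y) \<partial>p (X i \<omega>))"
    for h :: "'a \<times> 'b \<Rightarrow> real" and \<omega> i
  let ?L = "\<lambda>h \<omega> n. (\<Sum>i=1..n. D h \<omega> i) / real n"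
  have product: "AE \<omega> in M. ?L (\<lambda>z. \<phi> m q (fst z) * \<psi> m r (snd z)) \<omega> \<longlonglongrightarrow> 0" for m q r
  proof -
    obtain A B where "\<And>x. \<bar>\<phi> m q x\<bar> \<le> A" "\<And>y. \<bar>\<psi> m r y\<bar> \<le> B"
      using compact_UNIV_continuous_bounded[OF cpt(1) cont(1)[of m q]]
        compact_UNIV_continuous_bounded[OF cpt(2) cont(2)[of m r]] by (auto simp: bounded_iff)
    from transition_pairs_average_tendsto_0[OF p XY borel_measurable_continuous_onI[OF cont(1)] this(1)
        borel_measurable_continuous_onI[OF cont(2)] this(2)]
    show ?thesis by (simp add: D_def right_diff_distrib)
  qed
  have "AE \<omega> in M. \<forall>m. \<forall>q\<in>Q m. \<forall>r\<in>R m. ?L (\<lambda>z. \<phi> m q (fst z) * \<psi> m r (snd z)) \<omega> \<longlonglongrightarrow> 0"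
    using product fin by (simp add: AE_all_countable AE_finite_all)
  then show ?thesis
  proof eventually_elim
    case (elim \<omega>)
    show ?case
    proof (intro allI impI)
      fix h :: "'a \<times> 'b \<Rightarrow> real" assume h: "continuous_on UNIV h"
      have "?L h \<omega> \<longlonglongrightarrow> 0"
      proof (rule tendstoI)
        fix e :: real assume e: "e > 0"
        define H where "H m z = (\<Sum>q\<in>Q m. \<Sum>r\<in>R m. h (q, r) * (\<phi> m q (fst z) * \<psi> m r (snd z)))" for m z
        obtain m where m: "\<And>x y. \<bar>h (x, y) - H m (x, y)\<bar> \<le> e / 4"
          using approx[OF h, of "e / 4"] e by (auto simp: H_def)
        have H_cont: "continuous_on UNIV (H m)"
          unfolding H_def
          by (intro continuous_intros continuous_on_compose2[OF cont(1)] continuous_on_compose2[OF cont(2)]) auto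
        have cpt_UNIV: "compact (UNIV :: ('a \<times> 'b) set)"
          using compact_Times[OF cpt] by simp
        have slice_int: "integrable (p x) (\<lambda>y. g (x, y))" if g: "continuous_on UNIV g"
          for g :: "'a \<times> 'b \<Rightarrow> real" and x
        proof -
          obtain B where "\<And>z. \<bar>g z\<bar> \<le> B"
            using compact_UNIV_continuous_bounded[OF cpt_UNIV g] by (auto simp: bounded_iff)
          then show ?thesis
            by (intro markov_kernel_integral_bound(2)[OF p, where B=B] borel_measurable_continuous_onI
                continuous_on_compose2[OF g] continuous_intros) auto
        qed
        \<comment> \<open>One e/4 comes from the value at the pair, the other from the integral
          against the probability measure \<open>p (X i \<omega>)\<close>.\<close>
        have D_close: "\<bar>D h \<omega> i - D (H m) \<omega> i\<bar> \<le> e / 2" for i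
        proof -
          have "\<bar>\<integral>y. h (X i \<omega>, y) - H m (X i \<omega>, y) \<partial>p (X i \<omega>)\<bar> \<le> e / 4"
            by (intro markov_kernel_integral_bound(1)[OF p] borel_measurable_continuous_onI
                continuous_on_diff continuous_on_compose2[OF h] continuous_on_compose2[OF H_cont]
                continuous_intros m) auto
          then have "\<bar>(\<integral>y. h (X i \<omega>, y) \<partial>p (X i \<omega>)) - (\<integral>y. H m (X i \<omega>, y) \<partial>p (X i \<omega>))\<bar> \<le> e / 4"
            by (simp only: Bochner_Integration.integral_diff slice_int h H_cont)
          then show ?thesis
            unfolding D_def using m[of "X i \<omega>" "Y i \<omega>"] by linarith
        qed
        have close: "\<bar>?L h \<omega> n - ?L (H m) \<omega> n\<bar> \<le> e / 2" for n
        proof -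
          have "\<bar>(\<Sum>i=1..n. D h \<omega> i) - (\<Sum>i=1..n. D (H m) \<omega> i)\<bar> \<le> (\<Sum>i=1..n. e / 2)"
            unfolding sum_subtractf[symmetric] by (intro order_trans[OF sum_abs] sum_mono D_close)
          then show ?thesis
            using e by (cases "n = 0") (auto simp: diff_divide_distrib[symmetric] abs_divide field_simps)
        qed
        have slice_product: "integrable (p x) (\<lambda>y. c * (\<phi> m q x * \<psi> m r y))" for c q r x
          using slice_int[of "\<lambda>z. c * (\<phi> m q (fst z) * \<psi> m r (snd z))" x]
          by (simp add: continuous_intros continuous_on_compose2[OF cont(1)] continuous_on_compose2[OF cont(2)])
        \<comment> \<open>\<open>D\<close> is linear in the test function, so the average for
          \<open>H m\<close> is a finite combination of the averages that \<open>elim\<close>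
          controls. Only the coefficients depend on \<open>h\<close>; the null set does not.\<close>
        have D_H: "D (H m) \<omega> i = (\<Sum>q\<in>Q m. \<Sum>r\<in>R m. h (q, r) * D (\<lambda>z. \<phi> m q (fst z) * \<psi> m r (snd z)) \<omega> i)" for i
        proof -
          have "(\<integral>y. H m (x, y) \<partial>p x)
              = (\<Sum>q\<in>Q m. \<Sum>r\<in>R m. \<integral>y. h (q, r) * (\<phi> m q x * \<psi> m r y) \<partial>p x)" for x
            unfolding H_def fst_conv snd_conv
            by (subst Bochner_Integration.integral_sum,
                intro Bochner_Integration.integrable_sum slice_product,
                intro sum.cong refl Bochner_Integration.integral_sum slice_product)
          then show ?thesis
            by (simp add: D_def H_def right_diff_distrib sum_subtractf)
        qed
        have "(\<Sum>i=1..n. D (H m) \<omega> i) = (\<Sum>q\<in>Q m. \<Sum>r\<in>R m.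
            h (q, r) * (\<Sum>i=1..n. D (\<lambda>z. \<phi> m q (fst z) * \<psi> m r (snd z)) \<omega> i))" for n
          unfolding D_H sum_distrib_left
          by (subst sum.swap, intro sum.cong refl, rule sum.swap)
        then have "?L (H m) \<omega> = (\<lambda>n. \<Sum>q\<in>Q m. \<Sum>r\<in>R m.
            h (q, r) * ?L (\<lambda>z. \<phi> m q (fst z) * \<psi> m r (snd z)) \<omega> n)"
          by (simp add: sum_divide_distrib[of _ "Q m"] sum_divide_distrib[of _ "R m"])
        moreover have "\<dots> \<longlonglongrightarrow> 0"
          using elim by (intro tendsto_null_sum tendsto_mult_right_zero) auto
        ultimately have "?L (H m) \<omega> \<longlonglongrightarrow> 0" by simp
        then have "\<forall>\<^sub>F n in sequentially. dist (?L (H m) \<omega> n) 0 < e / 2"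
          using e by (intro tendstoD) auto
        then show "\<forall>\<^sub>F n in sequentially. dist (?L h \<omega> n) 0 < e"
        proof eventually_elim
          case (elim n)
          then show ?case using close[of n] unfolding dist_real_def by linarith
        qed
      qed
      then show "(\<lambda>n. (\<Sum>i=1..n. h (X i \<omega>, Y i \<omega>) - (\<integral>y. h (X i \<omega>, y) \<partial>p (X i \<omega>))) / real n) \<longlonglongrightarrow> 0"
        by (simp add: D_def)
    qed
  qed
qed

text \<open>A statement about one trajectory. The integral of \<open>h\<close> against the pairs is
  the average in \<open>law\<close> plus the integral of \<open>?K\<close> against the empirical
  measure of \<open>x\<close>. The former vanishes in the limit; the latter converges since
  \<open>?K\<close> is itself a test function, by the Feller property.\<close>

lemma empirical_measure_lift_kernel_joint:
  fixes p :: "'a::{metric_space, second_countable_topology} \<Rightarrow> 'b::{metric_space, second_countable_topology} measure"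
  assumes cpt: "compact (UNIV :: 'a set)" "compact (UNIV :: 'b set)"
    and p: "markov_kernel p" "feller_continuous p"
    and law: "\<And>h. continuous_on UNIV h \<Longrightarrow>
      (\<lambda>n. (\<Sum>i=1..n. h (x i, y i) - (\<integral>v. h (x i, v) \<partial>p (x i))) / real n) \<longlonglongrightarrow> 0"
    and r: "filterlim r at_top sequentially"
    and lim: "limitin weak_topology (\<lambda>k. empirical_measure x (r k)) \<mu> sequentially"
  shows "limitin weak_topology (\<lambda>k. empirical_measure (\<lambda>i. (x i, y i)) (r k)) (kernel_joint p \<mu>) sequentially"
  unfolding limitin_weak_topology
proof (intro conjI allI impI)
  have \<mu>: "\<mu> \<in> space (prob_algebra borel)"
    using lim by (simp add: limitin_weak_topology)
  then show "kernel_joint p \<mu> \<in> space (prob_algebra borel)"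
    using p(1) by (intro kernel_joint_in_prob_algebra)
  show "\<forall>\<^sub>F k in sequentially. empirical_measure (\<lambda>i. (x i, y i)) (r k) \<in> space (prob_algebra borel)"
    using r by (rule eventually_empirical_measure_in_prob_algebra)
  fix h :: "'a \<times> 'b \<Rightarrow> real" assume "continuous_on UNIV h \<and> bounded (range h)"
  then have h: "continuous_on UNIV h" and "bounded (range h)" by auto
  then obtain B where B: "\<And>z. \<bar>h z\<bar> \<le> B" by (auto simp: bounded_iff)
  let ?K = "\<lambda>x. \<integral>v. h (x, v) \<partial>p x"
  have K: "continuous_on UNIV ?K"
    using cpt p h by (rule continuous_on_kernel_integral)
  have "(\<lambda>k. \<integral>x. ?K x \<partial>empirical_measure x (r k)) \<longlonglongrightarrow> (\<integral>x. ?K x \<partial>\<mu>)"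
    using lim K compact_UNIV_continuous_bounded[OF cpt(1) K] by (simp add: limitin_weak_topology)
  then have "(\<lambda>k. (\<Sum>i=1..r k. h (x i, y i) - ?K (x i)) / real (r k) + (\<integral>x. ?K x \<partial>empirical_measure x (r k)))
      \<longlonglongrightarrow> 0 + (\<integral>x. ?K x \<partial>\<mu>)"
    by (intro tendsto_add filterlim_compose[OF law[OF h] r])
  moreover have "\<forall>\<^sub>F k in sequentially.
      (\<Sum>i=1..r k. h (x i, y i) - ?K (x i)) / real (r k) + (\<integral>x. ?K x \<partial>empirical_measure x (r k))
      = (\<integral>z. h z \<partial>empirical_measure (\<lambda>i. (x i, y i)) (r k))"
    using filterlim_at_top[THEN iffD1, OF r, rule_format, of 1]
    by eventually_elim
      (simp add: integral_empirical_measure borel_measurable_continuous_onI h K sum_subtractf diff_divide_distrib)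
  ultimately have "(\<lambda>k. \<integral>z. h z \<partial>empirical_measure (\<lambda>i. (x i, y i)) (r k)) \<longlonglongrightarrow> 0 + (\<integral>x. ?K x \<partial>\<mu>)"
    by (rule Lim_transform_eventually)
  then show "(\<lambda>k. \<integral>z. h z \<partial>empirical_measure (\<lambda>i. (x i, y i)) (r k)) \<longlonglongrightarrow> (\<integral>z. h z \<partial>kernel_joint p \<mu>)"
    using integral_kernel_joint[OF p(1) \<mu> borel_measurable_continuous_onI[OF h] B] by simp
qed

lemma empirical_measure_limit_marginal:
  fixes z :: "nat \<Rightarrow> 'a::second_countable_topology \<times> 'b::second_countable_topology"
  assumes r: "filterlim r at_top sequentially"
    and lim: "limitin weak_topology (\<lambda>k. empirical_measure z (r k)) \<nu> sequentially"
  shows "limitin weak_topology (\<lambda>k. empirical_measure (\<lambda>i. fst (z i)) (r k)) (distr \<nu> borel fst) sequentially"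
proof (rule limitin_transform_eventually[rotated])
  show "limitin weak_topology ((\<lambda>\<mu>. distr \<mu> borel fst) \<circ> (\<lambda>k. empirical_measure z (r k))) (distr \<nu> borel fst) sequentially"
    using continuous_map_marginal lim by (rule continuous_map_limit)
  show "\<forall>\<^sub>F k in sequentially. ((\<lambda>\<mu>. distr \<mu> borel fst) \<circ> (\<lambda>k. empirical_measure z (r k))) k
      = empirical_measure (\<lambda>i. fst (z i)) (r k)"
    using filterlim_at_top[THEN iffD1, OF r, rule_format, of 1]
    by eventually_elim (simp add: empirical_measure_marginal)
qed

section \<open>Transfer of convergence between the two processes and identification of the
  limit\<close>

theorem theorem3p19:
  fixes M :: "'w measure"
    and p :: "'a::polish_space \<Rightarrow> 'b::polish_space measure"
    and X :: "nat \<Rightarrow> 'w \<Rightarrow> 'a" and Y :: "nat \<Rightarrow> 'w \<Rightarrow> 'b"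
    and Z :: "nat \<Rightarrow> 'w \<Rightarrow> 'a \<times> 'b"
    and dX :: "'a measure \<Rightarrow> 'a measure \<Rightarrow> real"
    and dZ :: "('a \<times> 'b) measure \<Rightarrow> ('a \<times> 'b) measure \<Rightarrow> real"
  assumes "complete_standard_borel_prob_space M"
    and "compact (UNIV :: 'a set)" and "compact (UNIV :: 'b set)"
    and "metrizes_weak_convergence dX" and "metrizes_weak_convergence dZ"
    and "markov_kernel p" and "feller_continuous p"
    and "transition_pairs M p X Y"
    and "\<And>n \<omega>. Z n \<omega> = (X n \<omega>, Y n \<omega>)"
  shows "(EWC_prob M dZ Z \<longleftrightarrow> EWC_prob M dX X) \<and>
         (EWC_as M dZ Z \<longleftrightarrow> EWC_as M dX X) \<and>
         (\<forall>P J. (limit_measure_prob M dX X P \<and> limit_measure_prob M dZ Z J) \<or>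
                (limit_measure_as M dX X P \<and> limit_measure_as M dZ Z J) \<longrightarrow>
            (AE \<omega> in M. \<forall>A\<in>sets borel. \<forall>B\<in>sets borel.
               measure (J \<omega>) (A \<times> B) = (LINT x:A|P \<omega>. measure (p x) B)))"
proof -
  have M: "prob_space M"
    using assms(1) prob_space.prob_space_completion
    unfolding complete_standard_borel_prob_space_def by blast
  interpret prob_space M by fact
  note p = \<open>markov_kernel p\<close> \<open>feller_continuous p\<close> and cpt = assms(2,3)
  have Z_eq: "Z = (\<lambda>n \<omega>. (X n \<omega>, Y n \<omega>))"
    using assms(9) by (intro ext)
  have X: "\<forall>i\<ge>1. X i \<in> M \<rightarrow>\<^sub>M borel" and Z: "\<forall>i\<ge>1. Z i \<in> M \<rightarrow>\<^sub>M borel"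
    using assms(8) by (auto simp: transition_pairs_def Z_eq intro!: borel_measurable_Pair)
  let ?uX = "\<lambda>P n \<omega>. dX (empirical_measure (\<lambda>i. X i \<omega>) n) (P \<omega>)"
  let ?uZ = "\<lambda>J n \<omega>. dZ (empirical_measure (\<lambda>i. Z i \<omega>) n) (J \<omega>)"
  let ?joint = "\<lambda>P \<omega>. kernel_joint p (P \<omega>)"
  let ?marginal = "\<lambda>J \<omega>. distr (J \<omega>) borel (fst :: 'a \<times> 'b \<Rightarrow> 'a)"
  have joint: "random_measure M (?joint P)" if "random_measure M P" for P
    using that continuous_map_kernel_joint[OF cpt p] by (rule random_measure_continuous_image)
  have marginal: "random_measure M (?marginal J)" if "random_measure M J" for J
    using that continuous_map_marginal by (rule random_measure_continuous_image)
  note in_prob = eventually_empirical_measure_in_prob_algebra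
  note limX = metrizes_weak_convergence_limitin[OF assms(4) _ in_prob]
  note limZ = metrizes_weak_convergence_limitin[OF assms(5) _ in_prob]
  \<comment> \<open>With \<open>r\<close> the identity this settles almost sure convergence, with
    \<open>r\<close> a subsequence convergence in probability.\<close>
  have lift: "AE \<omega> in M. (\<lambda>k. ?uZ (?joint P) (r k) \<omega>) \<longlonglongrightarrow> 0"
    if P: "random_measure M P" and r: "filterlim r at_top sequentially"
      and conv: "AE \<omega> in M. (\<lambda>k. ?uX P (r k) \<omega>) \<longlonglongrightarrow> 0" for P r
    using transition_pairs_continuous_average_tendsto_0[OF cpt M p(1) assms(8)] conv AE_space
  proof eventually_elim
    case (elim \<omega>)
    have "limitin weak_topology (\<lambda>k. empirical_measure (\<lambda>i. X i \<omega>) (r k)) (P \<omega>) sequentially"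
      using elim limX[OF random_measure_in_space[OF P] r] by blast
    with elim(1) have "limitin weak_topology (\<lambda>k. empirical_measure (\<lambda>i. Z i \<omega>) (r k)) (?joint P \<omega>) sequentially"
      unfolding Z_eq by (intro empirical_measure_lift_kernel_joint[OF cpt p _ r]) auto
    then show ?case
      using limZ[OF random_measure_in_space[OF joint[OF P]] r] elim(3) by blast
  qed
  have project: "AE \<omega> in M. (\<lambda>k. ?uX (?marginal J) (r k) \<omega>) \<longlonglongrightarrow> 0"
    if J: "random_measure M J" and r: "filterlim r at_top sequentially"
      and conv: "AE \<omega> in M. (\<lambda>k. ?uZ J (r k) \<omega>) \<longlonglongrightarrow> 0" for J r
    using conv AE_space
  proof eventually_elim
    case (elim \<omega>)
    have "limitin weak_topology (\<lambda>k. empirical_measure (\<lambda>i. Z i \<omega>) (r k)) (J \<omega>) sequentially"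
      using elim limZ[OF random_measure_in_space[OF J] r] by blast
    from empirical_measure_limit_marginal[OF r this]
    have "limitin weak_topology (\<lambda>k. empirical_measure (\<lambda>i. X i \<omega>) (r k)) (?marginal J \<omega>) sequentially"
      by (simp add: Z_eq)
    then show ?case
      using limX[OF random_measure_in_space[OF marginal[OF J]] r] elim(2) by blast
  qed
  note prob_X = limit_measure_prob_iff_subseq[OF M assms(4) X]
  note prob_Z = limit_measure_prob_iff_subseq[OF M assms(5) Z]
  have subseq: "filterlim (\<lambda>k. s (r k)) at_top sequentially" if "strict_mono s" "strict_mono r"
    for s r :: "nat \<Rightarrow> nat"
    using that by (intro filterlim_compose[OF filterlim_subseq filterlim_subseq])
  have "limit_measure_prob M dZ Z (?joint P)" if "limit_measure_prob M dX X P" for P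
    unfolding prob_Z
  proof (intro conjI allI impI)
    from that have P: "random_measure M P" by (simp add: limit_measure_prob_def)
    then show "random_measure M (?joint P)" by (rule joint)
    fix s :: "nat \<Rightarrow> nat" assume s: "strict_mono s"
    with that obtain r where "strict_mono r" "AE \<omega> in M. (\<lambda>k. ?uX P (s (r k)) \<omega>) \<longlonglongrightarrow> 0"
      unfolding prob_X by blast
    with lift[OF P subseq[OF s]] show
      "\<exists>r. strict_mono r \<and> (AE \<omega> in M. (\<lambda>k. ?uZ (?joint P) (s (r k)) \<omega>) \<longlonglongrightarrow> 0)" by blast
  qed
  moreover have "limit_measure_prob M dX X (?marginal J)" if "limit_measure_prob M dZ Z J" for J
    unfolding prob_X
  proof (intro conjI allI impI)
    from that have J: "random_measure M J" by (simp add: limit_measure_prob_def)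
    then show "random_measure M (?marginal J)" by (rule marginal)
    fix s :: "nat \<Rightarrow> nat" assume s: "strict_mono s"
    with that obtain r where "strict_mono r" "AE \<omega> in M. (\<lambda>k. ?uZ J (s (r k)) \<omega>) \<longlonglongrightarrow> 0"
      unfolding prob_Z by blast
    with project[OF J subseq[OF s]] show
      "\<exists>r. strict_mono r \<and> (AE \<omega> in M. (\<lambda>k. ?uX (?marginal J) (s (r k)) \<omega>) \<longlonglongrightarrow> 0)" by blast
  qed
  ultimately have "EWC_prob M dZ Z \<longleftrightarrow> EWC_prob M dX X"
    unfolding EWC_prob_def by blast
  moreover have "EWC_as M dZ Z \<longleftrightarrow> EWC_as M dX X"
    using lift[OF _ filterlim_ident] project[OF _ filterlim_ident] joint marginal
    unfolding EWC_as_def limit_measure_as_def by blast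
  moreover have "AE \<omega> in M. \<forall>A\<in>sets borel. \<forall>B\<in>sets borel.
      measure (J \<omega>) (A \<times> B) = (LINT x:A|P \<omega>. measure (p x) B)"
    if lim: "(limit_measure_prob M dX X P \<and> limit_measure_prob M dZ Z J) \<or>
        (limit_measure_as M dX X P \<and> limit_measure_as M dZ Z J)" for P J
  proof -
    have P: "random_measure M P" and J: "random_measure M J"
      using lim by (auto simp: limit_measure_prob_def limit_measure_as_def)
    \<comment> \<open>Both convergences are needed along the same indices. In probability, a
      subsequence is extracted for \<open>X\<close> and then a further one for \<open>Z\<close>,
      which keeps the first convergence.\<close>
    have "\<exists>r. strict_mono r \<and> (AE \<omega> in M. (\<lambda>k. ?uX P (r k) \<omega>) \<longlonglongrightarrow> 0) \<and>
        (AE \<omega> in M. (\<lambda>k. ?uZ J (r k) \<omega>) \<longlonglongrightarrow> 0)"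
      using lim
    proof
      assume L: "limit_measure_prob M dX X P \<and> limit_measure_prob M dZ Z J"
      then obtain s where s: "strict_mono s" "AE \<omega> in M. (\<lambda>k. ?uX P (s k) \<omega>) \<longlonglongrightarrow> 0"
        unfolding prob_X using strict_mono_id by auto
      then obtain r where r: "strict_mono r" "AE \<omega> in M. (\<lambda>k. ?uZ J (s (r k)) \<omega>) \<longlonglongrightarrow> 0"
        using L unfolding prob_Z by blast
      have "AE \<omega> in M. (\<lambda>k. ?uX P (s (r k)) \<omega>) \<longlonglongrightarrow> 0"
        using s(2) by eventually_elim (rule filterlim_compose[OF _ filterlim_subseq[OF r(1)]])
      with r show ?thesis
        using strict_mono_o[OF s(1) r(1)] by (auto simp: comp_def)
    next
      assume "limit_measure_as M dX X P \<and> limit_measure_as M dZ Z J"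
      then show ?thesis
        by (intro exI[of _ "\<lambda>k. k"]) (auto simp: limit_measure_as_def strict_mono_def)
    qed
    then obtain r where r: "strict_mono r" "AE \<omega> in M. (\<lambda>k. ?uX P (r k) \<omega>) \<longlonglongrightarrow> 0"
      "AE \<omega> in M. (\<lambda>k. ?uZ J (r k) \<omega>) \<longlonglongrightarrow> 0" by blast
    note r_top = filterlim_subseq[OF r(1)]
    from lift[OF P r_top r(2)] r(3) AE_space show ?thesis
    proof eventually_elim
      case (elim \<omega>)
      \<comment> \<open>Both measures are limits of the same empirical measures of \<open>Z\<close>
        along \<open>r\<close>, and limits are unique for \<open>dZ\<close>.\<close>
      have "?joint P \<omega> = J \<omega>"
        using random_measure_in_space[OF joint[OF P] elim(3)] random_measure_in_space[OF J elim(3)]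
          in_prob[OF r_top] sequentially_bot elim(1,2)
        by (rule metrizes_weak_convergence_unique[OF assms(5)])
      then show ?case
        using measure_kernel_joint_Times[OF p(1) random_measure_in_space[OF P elim(3)]] by metis
    qed
  qed
  ultimately show ?thesis by blast
qed

end
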